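(* Let $m\ge2$ be an integer and let $\omega_m$ be the $m$-th multinacci number. The set of uniqueness $\mathcal{U}_{\omega_m}$ is a self-similar set of Hausdorff dimension $$\dim_H(\mathcal{U}_{\omega_m})=\frac{\log\sigma_m}{\log\omega_m},$$ where $\sigma_m\in(0,1)$ is the smaller positive root of $2t^m-3t+1$. In particular, $\sigma_2=1/2$.
   Context: Let $\mathbf p_k=\frac23(\cos(2\pi k/3),\sin(2\pi k/3))\in\mathbb{R}^2$, $k=0,1,2$. For $\lambda\in(0,1)$ let $f_i(\mathbf x)=\lambda\mathbf x+(1-\lambda)\mathbf p_i$, $i=0,1,2$. The invariant set $\mathcal{S}_\lambda$ is the unique non-empty compact set with $\mathcal{S}_\lambda=\bigcup_{i=0}^2 f_i(\mathcal{S}_\lambda)$. Let $\Sigma=\{0,1,2\}$. To any $\boldsymbol\varepsilon=(\varepsilon_0,\varepsilon_1,\dots)\in\Sigma^\infty$ corresponds the point $\mathbf x_{\boldsymbol\varepsilon}=\lim_{n\to\infty}f_{\varepsilon_0}\cdots f_{\varepsilon_n}(\mathbf x_0)\in\mathcal{S}_\lambda$, which does not depend on $\mathbf x_0$; $\boldsymbol\varepsilon$ is called an address of $\mathbf x_{\boldsymbol\varepsilon}$. The set of uniqueness $\mathcal{U}_\lambda$ is the set of points $\mathbf x\in\mathcal{S}_\lambda$ having exactly one address $\boldsymbol\varepsilon\in\Sigma^\infty$. For $m\ge2$ the multinacci number $\omega_m$ is the unique positive root of $x^m+x^{m-1}+\cdots+x=1$. $\dim_H$ denotes Hausdorff dim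ension.
   Formalization: "Self-similar set" is read in the graph-directed sense (one of finitely many bounded sets, each a finite union of contracted similar copies of them), without compactness, because the set of uniqueness is not closed and so is not a compact self-similar set. *)

theory Defs
  imports "HOL-Analysis.Analysis"
begin

section \<open>The gasket and its set of uniqueness\<close>

definition gasket_vertex :: "nat \<Rightarrow> real ^ 2" where
  "gasket_vertex k = (2 / 3) *\<^sub>R vector [cos (2 * pi * real k / 3), sin (2 * pi * real k / 3)]"

definition gasket_map :: "real \<Rightarrow> nat \<Rightarrow> real ^ 2 \<Rightarrow> real ^ 2" where
  "gasket_map l i x = l *\<^sub>R x + (1 - l) *\<^sub>R gasket_vertex i"

text \<open>The definite description is legitimate for 0 < l < 1, by Hutchinson's theorem.\<close>

definition gasket :: "real \<Rightarrow> (real ^ 2) set" where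
  "gasket l = (THE S. S \<noteq> {} \<and> compact S \<and> S = (\<Union>i\<in>{0, 1, 2}. gasket_map l i ` S))"

primrec address_map :: "real \<Rightarrow> (nat \<Rightarrow> nat) \<Rightarrow> nat \<Rightarrow> real ^ 2 \<Rightarrow> real ^ 2" where
  "address_map l \<epsilon> 0 = gasket_map l (\<epsilon> 0)"
| "address_map l \<epsilon> (Suc n) = address_map l \<epsilon> n \<circ> gasket_map l (\<epsilon> (Suc n))"

definition is_address :: "real \<Rightarrow> (nat \<Rightarrow> nat) \<Rightarrow> real ^ 2 \<Rightarrow> bool" where
  "is_address l \<epsilon> x \<longleftrightarrow>
     (\<forall>n. \<epsilon> n \<in> {0, 1, 2}) \<and> (\<forall>x0. (\<lambda>n. address_map l \<epsilon> n x0) \<longlonglongrightarrow> x)"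

definition uniqueness_set :: "real \<Rightarrow> (real ^ 2) set" where
  "uniqueness_set l = {x \<in> gasket l. \<exists>!\<epsilon>. is_address l \<epsilon> x}"

definition multinacci :: "nat \<Rightarrow> real" where
  "multinacci m = (THE x. 0 < x \<and> (\<Sum>k = 1..m. x ^ k) = 1)"

text \<open>For m at least 2 the polynomial has exactly two positive roots, one of them being 1.\<close>

definition sigma_root :: "nat \<Rightarrow> real" where
  "sigma_root m = Min {t. 0 < t \<and> 2 * t ^ m - 3 * t + 1 = 0}"

section \<open>Hausdorff measure and dimension\<close>

text \<open>The diameter to the power s, with the usual conventions that the empty set contributes
  nothing and that a nonempty set contributes 1 for s = 0 (in HOL, 0 powr 0 = 0).\<close>

definition diam_weight :: "real \<Rightarrow> 'a::metric_space set \<Rightarrow> ennreal" where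
  "diam_weight s C =
     (if C = {} then 0 else if s = 0 then 1 else ennreal (diameter C powr s))"

text \<open>Boundedness is required explicitly, as the diameter of an unbounded set is unspecified.\<close>

definition hausdorff_premeasure :: "real \<Rightarrow> real \<Rightarrow> 'a::metric_space set \<Rightarrow> ennreal" where
  "hausdorff_premeasure s d A =
     (INF C \<in> {C :: nat \<Rightarrow> 'a set.
                 A \<subseteq> (\<Union>i. C i) \<and> (\<forall>i. bounded (C i) \<and> diameter (C i) \<le> d)}.
        \<Sum>i. diam_weight s (C i))"

definition hausdorff_measure :: "real \<Rightarrow> 'a::metric_space set \<Rightarrow> ennreal" where
  "hausdorff_measure s A = (SUP d \<in> {0<..}. hausdorff_premeasure s d A)"

definition hausdorff_dim :: "'a::metric_space set \<Rightarrow> ereal" where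
  "hausdorff_dim A = Inf {ereal s | s. 0 \<le> s \<and> hausdorff_measure s A = 0}"

section \<open>Self-similar sets\<close>

definition contracting_similarity :: "('a::metric_space \<Rightarrow> 'a) \<Rightarrow> bool" where
  "contracting_similarity g \<longleftrightarrow> (\<exists>r. 0 < r \<and> r < 1 \<and> (\<forall>x y. dist (g x) (g y) = r * dist x y))"

text \<open>Self-similarity in the graph-directed sense of Mauldin and Williams: A is one of finitely many
  nonempty bounded sets K u, attached to the vertices of a finite directed graph, each of which is
  exactly the union of the images of the K t under the similarities labelling the edges from u to t.
  A graph with one vertex gives the sets invariant under a finite family of similarities.

  Compactness is deliberately not required. Sets of uniqueness need not be closed: for the golden
  ratio (m = 2) the points of address 0 1 2 1 2 ... have a second address, but they are limits of
  points with a unique address. The closures of the K u satisfy the same system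
  (see closure_graph_invariant below), so they are the graph-directed attractor in the usual,
  compact sense.

  More than one vertex is needed as well. For m = 2 let U be the set of uniqueness and suppose
  that U is the union of its images under contracting similarities g. Some g(U) contains the
  vertex p of the gasket triangle. As U spans the triangle, p is the image of a vertex, and by
  symmetry one may take g to be a homothety with centre p. Then g maps another vertex, which
  belongs to U, into the interior of a side of the triangle; but all points there have several
  addresses.\<close>

definition graph_invariant ::
  "'v set \<Rightarrow> ('v \<times> ('a::metric_space \<Rightarrow> 'a) \<times> 'v) set \<Rightarrow> ('v \<Rightarrow> 'a set) \<Rightarrow> bool" where
  "graph_invariant V E K \<longleftrightarrow>
     (\<forall>u\<in>V. K u = (\<Union>(g, t)\<in>{(g, t). (u, g, t) \<in> E}. g ` K t))"

definition self_similar :: "'a::metric_space set \<Rightarrow> bool" where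
  "self_similar A \<longleftrightarrow>
     (\<exists>(V :: nat set) E K.
        finite V \<and> finite E \<and>
        (\<forall>(u, g, t)\<in>E. u \<in> V \<and> t \<in> V \<and> contracting_similarity g) \<and>
        (\<forall>u\<in>V. K u \<noteq> {} \<and> bounded (K u)) \<and>
        graph_invariant V E K \<and>
        (\<exists>u\<in>V. A = K u))"

lemma closure_similarity_image:
  fixes g :: "'a::heine_borel \<Rightarrow> 'a"
  assumes "contracting_similarity g" and "bounded S"
  shows "closure (g ` S) = g ` closure S"
proof
  from assms(1) obtain r where r: "0 < r" "r < 1" "\<And>x y. dist (g x) (g y) = r * dist x y"
    by (auto simp: contracting_similarity_def)
  have cont: "continuous_on (closure S) g"
    by (rule lipschitz_on_continuous_on[of r]) (use r in \<open>auto intro!: lipschitz_onI\<close>)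
  have "compact (g ` closure S)"
    using assms(2) by (intro compact_continuous_image cont) (simp add: compact_closure)
  then show "closure (g ` S) \<subseteq> g ` closure S"
    by (intro closure_minimal image_mono closure_subset compact_imp_closed)
  show "g ` closure S \<subseteq> closure (g ` S)"
    by (rule image_closure_subset[OF cont]) (auto simp: closure_subset)
qed

lemma closure_graph_invariant:
  fixes K :: "'v \<Rightarrow> 'a::heine_borel set"
  assumes "finite E" and "graph_invariant V E K"
    and E: "\<And>u g t. (u, g, t) \<in> E \<Longrightarrow> t \<in> V \<and> contracting_similarity g"
    and bdd: "\<And>u. u \<in> V \<Longrightarrow> bounded (K u)"
  shows "graph_invariant V E (\<lambda>u. closure (K u))"
  unfolding graph_invariant_def
proof
  fix u assume u: "u \<in> V"
  let ?I = "{(g, t). (u, g, t) \<in> E}"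
  have "?I \<subseteq> snd ` E" by force
  then have fin: "finite ?I" using assms(1) finite_subset by blast
  have "closure (K u) = closure (\<Union>e\<in>?I. fst e ` K (snd e))"
    using assms(2) u by (simp add: graph_invariant_def case_prod_beta)
  also have "\<dots> = (\<Union>e\<in>?I. closure (fst e ` K (snd e)))"
    using fin by (induction rule: finite_induct) (auto simp: closure_Un)
  also have "\<dots> = (\<Union>e\<in>?I. fst e ` closure (K (snd e)))"
    using E bdd by (intro SUP_cong refl closure_similarity_image) auto
  finally show "closure (K u) = (\<Union>(g, t)\<in>?I. g ` closure (K t))"
    by (simp add: case_prod_beta)
qed

end

theory Submission
  imports Defs
begin

text \<open>Write \<open>l\<close> for the multinacci number, so that \<open>l ^ Suc m = 2 * l - 1\<close>, and \<open>f_i\<close> for the three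
  contractions. The copies of the triangle under \<open>f_i\<close> and \<open>f_j\<close> overlap in a small triangle, and by
  the equation for \<open>l\<close> this is exactly the common image under \<open>f_i f_j ^ m = f_j f_i ^ m\<close>. Hence an
  address that contains a word \<open>i j ^ m\<close> with \<open>i \<noteq> j\<close> is not unique
  (\<open>unique_codes_not_begins\<close>), and up to boundary effects these are the only obstructions: an
  address that avoids such words and does not start with \<open>j\<close> has \<open>j\<close>-th barycentric coordinate at
  most \<open>1 - l\<close>, the least possible value for an address starting with \<open>j\<close>
  (\<open>admissible_bary_le\<close>). Equality does occur, as for \<open>0 1 2 1 2 \<dots>\<close> with \<open>m = 2\<close> and \<open>j = 1\<close>, but
  then the point lies on a side of a contracted triangle, all points of which have addresses, and
  uniqueness fails (\<open>unique_codes_bary_less\<close>).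

  For self-similarity, no description of the exceptional addresses is needed. If the tail of an
  address is unique, the address itself is unique unless it starts with \<open>i j ^ m\<close>
  (\<open>unique_codes_step\<close>). So the unique addresses that may follow a given word are determined by its
  last run, and finitely many states suffice: the graph is the automaton that records the digit and
  the length of the current run (\<open>self_similar_uniqueness_set\<close>).

  The number of words of length \<open>n\<close> that avoid all \<open>i j ^ m\<close> is of order \<open>\<sigma> ^ -n\<close>, where
  \<open>2 * (\<sigma> + \<dots> + \<sigma> ^ (m - 1)) = 1\<close>, because every run after the initial one has length less than
  \<open>m\<close> and each new run has a choice of two digits (\<open>card_words_bounds\<close>). Multiplied by \<open>1 - \<sigma>\<close>
  the equation becomes \<open>2 * \<sigma> ^ m - 3 * \<sigma> + 1 = 0\<close>. Covering by cylinders gives the upper bound of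
  the dimension. The set of uniqueness is not closed and the gaps between its points are not
  uniform, so the lower bound is proved on subsets: words of a fixed length are furnished with a
  separator and concatenated freely. Their addresses are unique with a uniform gap
  (\<open>spread_separation\<close>), and a mass distribution argument applies (\<open>hausdorff_measure_nonzeroI\<close>).
  Long words lose nothing of the growth rate, so these subsets exhaust the dimension.\<close>

section \<open>Roots of geometric sums\<close>

lemma geometric_sum_less:
  fixes x y :: real
  assumes "0 \<le> x" "x < y" "0 < n"
  shows "(\<Sum>k = 1..n. x ^ k) < (\<Sum>k = 1..n. y ^ k)"
  using assms by (intro sum_strict_mono power_strict_mono) auto

lemma geometric_sum_root_ex1:
  fixes c :: real
  assumes "0 < c" "0 < n"
  shows "\<exists>!x. 0 < x \<and> (\<Sum>k = 1..n. x ^ k) = c"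
proof (rule ex_ex1I)
  let ?f = "\<lambda>x::real. \<Sum>k = 1..n. x ^ k"
  have "c ^ 1 \<le> ?f c"
    using assms by (intro member_le_sum) auto
  moreover have "?f 0 = 0"
    by (simp add: sum.neutral)
  moreover have "continuous_on {0..c} ?f"
    by (intro continuous_intros)
  ultimately obtain x where "0 \<le> x" "x \<le> c" "?f x = c"
    using IVT'[of ?f 0 c c] assms by fastforce
  moreover from this \<open>?f 0 = 0\<close> \<open>0 < c\<close> have "x \<noteq> 0"
    by auto
  ultimately have "0 < x \<and> ?f x = c"
    by simp
  then show "\<exists>x. 0 < x \<and> ?f x = c"
    by auto
next
  fix x y :: real
  assume "0 < x \<and> (\<Sum>k = 1..n. x ^ k) = c" "0 < y \<and> (\<Sum>k = 1..n. y ^ k) = c"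
  then show "x = y"
    using geometric_sum_less[of x y n] geometric_sum_less[of y x n] assms(2)
    by (cases x y rule: linorder_cases) auto
qed

lemma geometric_sum_telescope:
  fixes x :: "'a::comm_ring_1"
  shows "(1 - x) * (\<Sum>k = 1..n. x ^ k) = x - x ^ Suc n"
proof (induction n)
  case (Suc n)
  have "(1 - x) * (\<Sum>k = 1..Suc n. x ^ k) = (1 - x) * (\<Sum>k = 1..n. x ^ k) + (1 - x) * x ^ Suc n"
    by (simp add: distrib_left)
  then show ?case
    unfolding Suc.IH by (simp add: left_diff_distrib)
qed simp

lemma geometric_sum_root_less_1:
  fixes x :: real
  assumes "0 < x" "(\<Sum>k = 1..n. x ^ k) = c" "c < real n"
  shows "x < 1"
proof (rule ccontr)
  assume "\<not> x < 1"
  then have "(\<Sum>k = 1..n. 1 ^ k) \<le> (\<Sum>k = 1..n. x ^ k)"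
    by (intro sum_mono power_mono) auto
  also have "(\<Sum>k = 1..n. 1 ^ k) = real n"
    by simp
  finally show False
    using assms by linarith
qed

lemma multinacci_root:
  assumes "m \<ge> 2"
  shows "0 < multinacci m" "multinacci m < 1" "(multinacci m) ^ Suc m = 2 * multinacci m - 1"
proof -
  let ?l = "multinacci m"
  have "0 < ?l \<and> (\<Sum>k = 1..m. ?l ^ k) = 1"
    unfolding multinacci_def using assms by (intro theI'[OF geometric_sum_root_ex1]) auto
  then have pos: "0 < ?l" and eq: "(\<Sum>k = 1..m. ?l ^ k) = 1"
    by blast+
  show "0 < ?l"
    by (fact pos)
  show "?l < 1"
    using geometric_sum_root_less_1[OF pos eq] assms by simp
  show "?l ^ Suc m = 2 * ?l - 1"
    using geometric_sum_telescope[of ?l m] unfolding eq mult_1_right by linarith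
qed

text \<open>The factor \<open>t - 1\<close> splits off from \<open>2 t ^ m - 3 t + 1\<close>; what remains says that \<open>1 / t\<close> is
  the growth rate of words composed of runs of length less than \<open>m\<close>, with two choices for the
  letter of each new run.\<close>

lemma sigma_root_geometric_sum:
  assumes "m \<ge> 2"
  shows "0 < sigma_root m" "sigma_root m < 1" "2 * (\<Sum>k = 1..m - 1. sigma_root m ^ k) = 1"
proof -
  have ex1: "\<exists>!s::real. 0 < s \<and> (\<Sum>k = 1..m - 1. s ^ k) = 1 / 2"
    using assms by (intro geometric_sum_root_ex1) auto
  then obtain s :: real where s: "0 < s" "(\<Sum>k = 1..m - 1. s ^ k) = 1 / 2"
    by blast
  with ex1 have uniq: "\<And>t. 0 < t \<Longrightarrow> (\<Sum>k = 1..m - 1. t ^ k) = 1 / 2 \<Longrightarrow> t = s"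
    by blast
  have "s < 1"
    using geometric_sum_root_less_1[OF s] assms by simp
  have factor: "2 * t ^ m - 3 * t + 1 = (1 - t) * (1 - 2 * (\<Sum>k = 1..m - 1. t ^ k))" for t :: real
  proof -
    have "(1 - t) * (1 - 2 * (\<Sum>k = 1..m - 1. t ^ k))
        = (1 - t) - 2 * ((1 - t) * (\<Sum>k = 1..m - 1. t ^ k))"
      by (simp only: right_diff_distrib mult_1_right mult.left_commute[of _ 2])
    also have "\<dots> = (1 - t) - 2 * (t - t ^ Suc (m - 1))"
      unfolding geometric_sum_telescope ..
    finally show ?thesis
      using assms by simp
  qed
  have "2 * t ^ m - 3 * t + 1 = 0 \<longleftrightarrow> t = s \<or> t = 1" if "0 < t" for t
    unfolding factor mult_eq_0_iff using s uniq[OF that] by auto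
  then have "{t. 0 < t \<and> 2 * t ^ m - 3 * t + 1 = 0} = {s, 1}"
    using s(1) by auto
  then have "sigma_root m = s"
    unfolding sigma_root_def using \<open>s < 1\<close> by simp
  then show "0 < sigma_root m" "sigma_root m < 1" "2 * (\<Sum>k = 1..m - 1. sigma_root m ^ k) = 1"
    using s \<open>s < 1\<close> by simp_all
qed

section \<open>Addresses and barycentric coordinates\<close>

definition codes :: "(nat \<Rightarrow> nat) set" where
  "codes = {\<epsilon>. \<forall>n. \<epsilon> n \<in> {0, 1, 2}}"

definition tail :: "nat \<Rightarrow> (nat \<Rightarrow> 'a) \<Rightarrow> nat \<Rightarrow> 'a" where
  "tail n \<epsilon> = (\<lambda>i. \<epsilon> (n + i))"

definition point :: "real \<Rightarrow> (nat \<Rightarrow> nat) \<Rightarrow> real ^ 2" where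
  "point l \<epsilon> = (\<Sum>n. ((1 - l) * l ^ n) *\<^sub>R gasket_vertex (\<epsilon> n))"

text \<open>The vertices have norm \<open>2 / 3\<close> and mutual inner products \<open>- 2 / 9\<close>, so this affine function is 1
  at the vertex \<open>j\<close> and 0 at the other two: a barycentric coordinate.\<close>

definition bary :: "nat \<Rightarrow> real ^ 2 \<Rightarrow> real" where
  "bary j x = 1 / 3 + 3 / 2 * (x \<bullet> gasket_vertex j)"

lemma codesD: "\<epsilon> \<in> codes \<Longrightarrow> \<epsilon> n \<in> {0, 1, 2}"
  by (simp add: codes_def)

lemma tail_codes: "\<epsilon> \<in> codes \<Longrightarrow> tail n \<epsilon> \<in> codes"
  by (simp add: codes_def tail_def)

lemma case_nat_codes: "a \<in> {0, 1, 2} \<Longrightarrow> \<epsilon> \<in> codes \<Longrightarrow> case_nat a \<epsilon> \<in> codes"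
  by (auto simp: codes_def split: nat.split)

lemma tail_apply: "tail n \<epsilon> i = \<epsilon> (n + i)"
  by (simp add: tail_def)

lemma tail_hd [simp]: "tail n \<epsilon> 0 = \<epsilon> n"
  by (simp add: tail_def)

lemma tail_0 [simp]: "tail 0 \<epsilon> = \<epsilon>"
  by (simp add: tail_def)

lemma tail_tail [simp]: "tail n (tail k \<epsilon>) = tail (k + n) \<epsilon>"
  by (simp add: tail_def add.assoc)

lemma tail_case_nat [simp]: "tail (Suc n) (case_nat a \<epsilon>) = tail n \<epsilon>"
  by (simp add: tail_def)

lemma case_nat_tail [simp]: "case_nat (\<epsilon> 0) (tail (Suc 0) \<epsilon>) = \<epsilon>"
  by (auto simp: fun_eq_iff tail_apply split: nat.split)

lemma norm_gasket_vertex [simp]: "norm (gasket_vertex k) = 2 / 3"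
proof -
  define x where "x = 2 * pi * real k / 3"
  have "gasket_vertex k \<bullet> gasket_vertex k = 4 / 9 * ((cos x)\<^sup>2 + (sin x)\<^sup>2)"
    unfolding gasket_vertex_def x_def[symmetric] distrib_left
    by (simp add: inner_vec_def sum_2 power2_eq_square)
  then show ?thesis
    unfolding norm_eq_square by (simp add: power2_eq_square)
qed

lemma bary_vertex:
  assumes "i \<in> {0, 1, 2}" "j \<in> {0, 1, 2}"
  shows "bary j (gasket_vertex i) = of_bool (i = j)"
proof -
  have "gasket_vertex i \<bullet> gasket_vertex j
      = 4 / 9 * cos (2 * pi * real i / 3 - 2 * pi * real j / 3)"
    by (simp add: gasket_vertex_def inner_vec_def sum_2 cos_diff algebra_simps)
  moreover have "cos (4 * pi / 3) = - (1 / 2)" "cos (2 * pi / 3) = - (1 / 2)"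
    using cos_2pi_minus[of "2 * pi / 3"] cos_120 by (simp_all add: mult.commute)
  ultimately show ?thesis
    using assms by (auto simp: bary_def)
qed

lemma sum_bary: "bary 0 x + bary 1 x + bary 2 x = 1"
proof -
  have "cos (pi * 4 / 3) = - (1 / 2)" "sin (pi * 4 / 3) = - (sqrt 3 / 2)"
    using cos_2pi_minus[of "pi * 2 / 3"] cos_120 sin_2pi_minus[of "pi * 2 / 3"] sin_120
    by (simp_all add: mult.commute)
  then have "gasket_vertex 0 + gasket_vertex 1 + gasket_vertex 2 = 0"
    using cos_120 sin_120
    by (simp add: gasket_vertex_def vec_eq_iff forall_2 mult.commute)
  then have "x \<bullet> gasket_vertex 0 + x \<bullet> gasket_vertex 1 + x \<bullet> gasket_vertex 2 = 0"
    by (metis inner_add_right inner_zero_right)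
  then show ?thesis
    by (simp add: bary_def)
qed

lemma bary_eqI:
  assumes "\<And>j. j \<in> {0, 1, 2} \<Longrightarrow> bary j x = bary j y"
  shows "x = y"
proof -
  have "x \<bullet> gasket_vertex 0 = y \<bullet> gasket_vertex 0" "x \<bullet> gasket_vertex 1 = y \<bullet> gasket_vertex 1"
    using assms[of 0] assms[of 1] by (simp_all add: bary_def)
  moreover have "sin (2 * pi / 3) \<noteq> 0"
    using sin_120 by (auto simp: mult.commute)
  ultimately show ?thesis
    by (simp add: gasket_vertex_def vec_eq_iff forall_2 inner_vec_def sum_2)
qed

lemma bary_dist: "\<bar>bary j x - bary j y\<bar> \<le> dist x y"
  using Cauchy_Schwarz_ineq2[of "x - y" "gasket_vertex j"]
  by (simp add: bary_def dist_norm inner_diff_left abs_if split: if_splits)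

lemma bary_gasket_map:
  assumes "i \<in> {0, 1, 2}" "j \<in> {0, 1, 2}"
  shows "bary j (gasket_map l i x) = l * bary j x + (1 - l) * of_bool (i = j)"
  unfolding bary_vertex[OF assms, symmetric] bary_def gasket_map_def inner_add_left
    inner_scaleR_left
  by (simp add: field_simps)

lemma contracting_similarity_gasket_map:
  assumes "0 < l" "l < 1"
  shows "contracting_similarity (gasket_map l i)"
  unfolding contracting_similarity_def
  using assms by (intro exI[of _ l]) (auto simp: gasket_map_def dist_norm scaleR_diff_right[symmetric])

locale ratio =
  fixes l :: real
  assumes l_pos: "0 < l" and l_less_1: "l < 1"
begin

lemma weights_sums: "(\<lambda>n. (1 - l) * l ^ n) sums 1"
  using sums_mult[OF geometric_sums[of l], of "1 - l"] l_pos l_less_1 by simp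

lemma norm_point_term: "norm (((1 - l) * l ^ n) *\<^sub>R gasket_vertex k) = (1 - l) * l ^ n * (2 / 3)"
  using l_pos l_less_1 by (simp add: abs_mult)

lemma point_summable_norm: "summable (\<lambda>n. norm (((1 - l) * l ^ n) *\<^sub>R gasket_vertex (\<epsilon> n)))"
  unfolding norm_point_term by (rule summable_mult2[OF sums_summable[OF weights_sums]])

lemma point_sums: "(\<lambda>n. ((1 - l) * l ^ n) *\<^sub>R gasket_vertex (\<epsilon> n)) sums point l \<epsilon>"
  unfolding point_def by (rule summable_sums[OF summable_norm_cancel[OF point_summable_norm]])

lemma norm_point_le: "norm (point l \<epsilon>) \<le> 2 / 3"
proof -
  have "norm (point l \<epsilon>) \<le> (\<Sum>n. norm (((1 - l) * l ^ n) *\<^sub>R gasket_vertex (\<epsilon> n)))"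
    unfolding point_def by (intro summable_norm point_summable_norm)
  also have "\<dots> = (\<Sum>n. (1 - l) * l ^ n * (2 / 3))"
    unfolding norm_point_term ..
  also have "\<dots> = 2 / 3"
    using sums_mult2[OF weights_sums, of "2 / 3"] by (simp add: sums_iff)
  finally show ?thesis .
qed

lemma point_tail: "point l \<epsilon> = gasket_map l (\<epsilon> 0) (point l (tail 1 \<epsilon>))"
proof -
  have "(\<lambda>n. l *\<^sub>R (((1 - l) * l ^ n) *\<^sub>R gasket_vertex (tail 1 \<epsilon> n))) sums (l *\<^sub>R point l (tail 1 \<epsilon>))"
    by (intro sums_scaleR_right point_sums)
  then have "(\<lambda>n. ((1 - l) * l ^ Suc n) *\<^sub>R gasket_vertex (\<epsilon> (Suc n))) sums (l *\<^sub>R point l (tail 1 \<epsilon>))"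
    by (simp add: mult_ac tail_apply)
  from sums_Suc[OF this]
  have "(\<lambda>n. ((1 - l) * l ^ n) *\<^sub>R gasket_vertex (\<epsilon> n)) sums gasket_map l (\<epsilon> 0) (point l (tail 1 \<epsilon>))"
    by (simp add: gasket_map_def)
  then show ?thesis
    using sums_unique2[OF point_sums] by blast
qed

lemma point_case_nat: "point l (case_nat a \<epsilon>) = gasket_map l a (point l \<epsilon>)"
  using point_tail[of "case_nat a \<epsilon>"] by simp

lemma gasket_map_eq_iff: "gasket_map l i x = gasket_map l i y \<longleftrightarrow> x = y"
  using l_pos by (simp add: gasket_map_def)

lemma bary_point_tail:
  assumes "\<epsilon> \<in> codes" "j \<in> {0, 1, 2}"
  shows "bary j (point l \<epsilon>) = l * bary j (point l (tail 1 \<epsilon>)) + (1 - l) * of_bool (\<epsilon> 0 = j)"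
  by (subst point_tail) (rule bary_gasket_map[OF codesD[OF assms(1)] assms(2)])

lemma bary_point_nonneg:
  assumes "\<epsilon> \<in> codes" "j \<in> {0, 1, 2}"
  shows "0 \<le> bary j (point l \<epsilon>)"
proof -
  let ?w = "\<lambda>n. (1 - l) * l ^ n"
  have "(\<lambda>n. ?w n * (1 / 3)
          + 3 / 2 * ((?w n *\<^sub>R gasket_vertex (\<epsilon> n)) \<bullet> gasket_vertex j))
        sums (1 * (1 / 3) + 3 / 2 * (point l \<epsilon> \<bullet> gasket_vertex j))"
    by (rule sums_add[OF sums_mult2[OF weights_sums]
          sums_mult[OF bounded_linear.sums[OF bounded_linear_inner_left point_sums]]])
  moreover have "?w n * (1 / 3) + 3 / 2 * ((?w n *\<^sub>R gasket_vertex (\<epsilon> n)) \<bullet> gasket_vertex j)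
      = ?w n * bary j (gasket_vertex (\<epsilon> n))" for n
    unfolding bary_def inner_scaleR_left distrib_left by simp
  ultimately have sums: "(\<lambda>n. ?w n * bary j (gasket_vertex (\<epsilon> n))) sums bary j (point l \<epsilon>)"
    by (simp only: bary_def[of j "point l \<epsilon>"] mult_1_left)
  have "0 \<le> ?w n * bary j (gasket_vertex (\<epsilon> n))" for n
    using bary_vertex[OF codesD[OF assms(1)] assms(2)] l_pos l_less_1 by simp
  then show ?thesis
    by (rule sums_le[OF _ sums_zero sums])
qed

lemma bary_point_le_1:
  assumes "\<epsilon> \<in> codes" "j \<in> {0, 1, 2}"
  shows "bary j (point l \<epsilon>) \<le> 1"
  using bary_point_nonneg[OF assms(1), of 0] bary_point_nonneg[OF assms(1), of 1]
    bary_point_nonneg[OF assms(1), of 2] sum_bary[of "point l \<epsilon>"] assms(2) by auto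

lemma bary_prefix_avoiding:
  assumes "\<epsilon> \<in> codes" "j \<in> {0, 1, 2}" "\<And>i. i < n \<Longrightarrow> \<epsilon> i \<noteq> j"
  shows "bary j (point l \<epsilon>) = l ^ n * bary j (point l (tail n \<epsilon>))"
  using assms(3)
proof (induction n)
  case (Suc n)
  then show ?case
    using bary_point_tail[OF tail_codes[OF assms(1), of n] assms(2)] by simp
qed simp

lemma bary_prefix_constant:
  assumes "\<epsilon> \<in> codes" "j \<in> {0, 1, 2}" "\<And>i. i < n \<Longrightarrow> \<epsilon> i = j"
  shows "bary j (point l \<epsilon>) = 1 - l ^ n * (1 - bary j (point l (tail n \<epsilon>)))"
  using assms(3)
proof (induction n)
  case (Suc n)
  then show ?case
    using bary_point_tail[OF tail_codes[OF assms(1), of n] assms(2)] by (simp add: algebra_simps)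
qed simp

lemma dist_point_prefix:
  assumes "\<And>i. i < n \<Longrightarrow> \<epsilon> i = \<epsilon>' i"
  shows "dist (point l \<epsilon>) (point l \<epsilon>') = l ^ n * dist (point l (tail n \<epsilon>)) (point l (tail n \<epsilon>'))"
  using assms
proof (induction n)
  case (Suc n)
  have "dist (gasket_map l a x) (gasket_map l a y) = l * dist x y" for a x y
    using l_pos by (simp add: gasket_map_def dist_norm scaleR_diff_right[symmetric])
  then have "dist (point l (tail n \<epsilon>)) (point l (tail n \<epsilon>'))
      = l * dist (point l (tail (Suc n) \<epsilon>)) (point l (tail (Suc n) \<epsilon>'))"
    using Suc.prems[of n] by (subst (1 2) point_tail) simp
  then show ?case
    using Suc by simp
qed simp

lemma dist_point_le:
  assumes "\<And>i. i < n \<Longrightarrow> \<epsilon> i = \<epsilon>' i"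
  shows "dist (point l \<epsilon>) (point l \<epsilon>') \<le> 2 * l ^ n"
proof -
  have "dist (point l (tail n \<epsilon>)) (point l (tail n \<epsilon>')) \<le> 2 / 3 + 2 / 3"
    using norm_point_le[of "tail n \<epsilon>"] norm_point_le[of "tail n \<epsilon>'"]
      norm_triangle_ineq4[of "point l (tail n \<epsilon>)" "point l (tail n \<epsilon>')"] by (simp add: dist_norm)
  then have "dist (point l (tail n \<epsilon>)) (point l (tail n \<epsilon>')) \<le> 2"
    by simp
  then have "l ^ n * dist (point l (tail n \<epsilon>)) (point l (tail n \<epsilon>')) \<le> l ^ n * 2"
    using l_pos by (intro mult_left_mono) auto
  then show ?thesis
    using dist_point_prefix[of n \<epsilon> \<epsilon>'] assms by (simp add: mult.commute)
qed

section \<open>The gasket is the set of addressed points\<close>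

lemma address_map_eq:
  "address_map l \<epsilon> n x
    = (\<Sum>k<Suc n. ((1 - l) * l ^ k) *\<^sub>R gasket_vertex (\<epsilon> k)) + l ^ Suc n *\<^sub>R x"
proof (induction n arbitrary: x)
  case (Suc n)
  then show ?case
    by (simp add: gasket_map_def scaleR_add_right mult.commute add_ac)
qed (simp add: gasket_map_def add.commute)

lemma address_map_tendsto:
  assumes "bounded (range x)"
  shows "(\<lambda>n. address_map l \<epsilon> n (x n)) \<longlonglongrightarrow> point l \<epsilon>"
proof -
  obtain B where B: "norm (x n) \<le> B" for n
    using assms by (auto simp: bounded_iff)
  have "(\<lambda>n. \<Sum>k<Suc n. ((1 - l) * l ^ k) *\<^sub>R gasket_vertex (\<epsilon> k)) \<longlonglongrightarrow> point l \<epsilon>"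
    using point_sums[of \<epsilon>] unfolding sums_def by (rule LIMSEQ_Suc)
  moreover have "(\<lambda>n. l ^ Suc n *\<^sub>R x n) \<longlonglongrightarrow> 0"
  proof (rule Lim_null_comparison)
    show "\<forall>\<^sub>F n in sequentially. norm (l ^ Suc n *\<^sub>R x n) \<le> l ^ Suc n * B"
      using B l_pos by (intro always_eventually allI) (simp add: mult_left_mono)
    have "(\<lambda>n. l ^ Suc n) \<longlonglongrightarrow> 0"
      using l_pos l_less_1 by (intro LIMSEQ_Suc LIMSEQ_power_zero) simp
    from tendsto_mult_left_zero[OF this, of B] show "(\<lambda>n. l ^ Suc n * B) \<longlonglongrightarrow> 0" .
  qed
  ultimately show ?thesis
    unfolding address_map_eq using tendsto_add by fastforce
qed

lemma is_address_iff: "is_address l \<epsilon> x \<longleftrightarrow> \<epsilon> \<in> codes \<and> x = point l \<epsilon>"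
proof -
  have "(\<lambda>n. address_map l \<epsilon> n x0) \<longlonglongrightarrow> point l \<epsilon>" for x0
    by (rule address_map_tendsto) simp
  then show ?thesis
    unfolding is_address_def codes_def using LIMSEQ_unique by blast
qed

end

text \<open>Tychonoff's theorem for the discrete space of digits.\<close>

lemma compact_codes: "compact codes"
proof -
  have "compactin (product_topology (\<lambda>_. euclidean) UNIV) (PiE UNIV (\<lambda>_::nat. {0, 1, 2::nat}))"
    unfolding compactin_PiE by (simp add: finite_imp_compact)
  moreover have "PiE UNIV (\<lambda>_::nat. {0, 1, 2::nat}) = codes"
    by (simp add: codes_def PiE_UNIV_domain Pi_def)
  ultimately show ?thesis
    by (simp add: euclidean_product_topology)
qed

definition unique_codes :: "real \<Rightarrow> (nat \<Rightarrow> nat) set" where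
  "unique_codes l = {\<epsilon> \<in> codes. \<forall>\<epsilon>' \<in> codes. point l \<epsilon>' = point l \<epsilon> \<longrightarrow> \<epsilon>' = \<epsilon>}"

context ratio
begin

lemma continuous_on_point: "continuous_on codes (point l)"
proof -
  have unif: "uniform_limit codes
      (\<lambda>n \<epsilon>. \<Sum>k<n. ((1 - l) * l ^ k) *\<^sub>R gasket_vertex (\<epsilon> k)) (point l) sequentially"
    unfolding point_def
    by (rule Weierstrass_m_test[where M = "\<lambda>n. (1 - l) * l ^ n * (2 / 3)"])
      (simp_all only: norm_point_term order_refl summable_mult2[OF sums_summable[OF weights_sums]])
  have "continuous_on codes (\<lambda>\<epsilon>. \<Sum>k<n. ((1 - l) * l ^ k) *\<^sub>R gasket_vertex (\<epsilon> k))" for n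
  proof (intro continuous_on_sum continuous_on_scaleR continuous_on_const)
    fix k :: nat
    have "continuous_on codes (\<lambda>\<epsilon>. \<epsilon> k)"
      by (rule continuous_on_subset[OF continuous_on_product_coordinates]) simp
    then show "continuous_on codes (\<lambda>\<epsilon>. gasket_vertex (\<epsilon> k))"
      by (rule continuous_on_compose2[of UNIV gasket_vertex, rotated]) simp_all
  qed
  then show ?thesis
    by (intro uniform_limit_theorem[OF _ unif] always_eventually) simp_all
qed

lemma address_in_invariant_set:
  assumes S: "compact S" "S = (\<Union>i\<in>{0, 1, 2}. gasket_map l i ` S)" and "x \<in> S"
  shows "\<exists>\<epsilon>\<in>codes. x = point l \<epsilon>"
proof -
  have "\<forall>y\<in>S. \<exists>p. fst p \<in> {0, 1, 2} \<and> snd p \<in> S \<and> y = gasket_map l (fst p) (snd p)"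
  proof
    fix y
    assume "y \<in> S"
    then have "y \<in> (\<Union>i\<in>{0, 1, 2}. gasket_map l i ` S)"
      by (subst S(2)[symmetric])
    then obtain i z where "i \<in> {0, 1, 2}" "z \<in> S" "y = gasket_map l i z"
      by blast
    then show "\<exists>p. fst p \<in> {0, 1, 2} \<and> snd p \<in> S \<and> y = gasket_map l (fst p) (snd p)"
      by (intro exI[of _ "(i, z)"]) simp
  qed
  from bchoice[OF this] obtain p where
    p: "\<And>y. y \<in> S \<Longrightarrow> fst (p y) \<in> {0, 1, 2} \<and> snd (p y) \<in> S \<and> y = gasket_map l (fst (p y)) (snd (p y))"
    by blast
  define y where "y n = ((\<lambda>z. snd (p z)) ^^ n) x" for n
  define \<epsilon> where "\<epsilon> n = fst (p (y n))" for n
  have y_in: "y n \<in> S" for n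
    by (induction n) (use p \<open>x \<in> S\<close> in \<open>auto simp: y_def\<close>)
  have y_step: "y n = gasket_map l (\<epsilon> n) (y (Suc n))" for n
    using p[OF y_in[of n]] by (simp add: \<epsilon>_def y_def)
  have "address_map l \<epsilon> n (y (Suc n)) = x" for n
  proof (induction n)
    case 0
    show ?case
      using y_step[of 0] by (simp add: y_def)
  next
    case (Suc n)
    then show ?case
      using y_step[of "Suc n"] by simp
  qed
  moreover have "bounded (range (\<lambda>n. y (Suc n)))"
    by (rule bounded_subset[OF compact_imp_bounded[OF S(1)]]) (use y_in in auto)
  then have "(\<lambda>n. address_map l \<epsilon> n (y (Suc n))) \<longlonglongrightarrow> point l \<epsilon>"
    by (rule address_map_tendsto)
  ultimately have "x = point l \<epsilon>"
    by (simp add: LIMSEQ_const_iff)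
  moreover have "\<epsilon> \<in> codes"
    using p[OF y_in] by (simp add: codes_def \<epsilon>_def)
  ultimately show ?thesis
    by blast
qed

lemma gasket_eq: "gasket l = point l ` codes"
  unfolding gasket_def
proof (rule the_equality)
  have "(\<lambda>_. 0) \<in> codes"
    by (simp add: codes_def)
  moreover have "point l ` codes = (\<Union>i\<in>{0, 1, 2}. gasket_map l i ` point l ` codes)"
  proof (intro set_eqI iffI)
    fix x
    assume "x \<in> point l ` codes"
    then obtain \<epsilon> where "\<epsilon> \<in> codes" "x = gasket_map l (\<epsilon> 0) (point l (tail 1 \<epsilon>))"
      using point_tail by blast
    then show "x \<in> (\<Union>i\<in>{0, 1, 2}. gasket_map l i ` point l ` codes)"
      using codesD[of \<epsilon> 0] tail_codes[of \<epsilon> 1] by blast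
  next
    fix x
    assume "x \<in> (\<Union>i\<in>{0, 1, 2}. gasket_map l i ` point l ` codes)"
    then obtain i \<epsilon> where "i \<in> {0, 1, 2}" "\<epsilon> \<in> codes" "x = point l (case_nat i \<epsilon>)"
      unfolding point_case_nat by blast
    then show "x \<in> point l ` codes"
      using case_nat_codes by blast
  qed
  ultimately show "point l ` codes \<noteq> {} \<and> compact (point l ` codes) \<and>
      point l ` codes = (\<Union>i\<in>{0, 1, 2}. gasket_map l i ` point l ` codes)"
    using compact_continuous_image[OF continuous_on_point compact_codes] by blast
next
  fix S
  assume S: "S \<noteq> {} \<and> compact S \<and> S = (\<Union>i\<in>{0, 1, 2}. gasket_map l i ` S)"
  show "S = point l ` codes"
  proof
    show "S \<subseteq> point l ` codes"
      using address_in_invariant_set S by blast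
    show "point l ` codes \<subseteq> S"
    proof
      fix x
      assume "x \<in> point l ` codes"
      then obtain \<epsilon> where \<epsilon>: "\<epsilon> \<in> codes" "x = point l \<epsilon>"
        by blast
      obtain z where "z \<in> S"
        using S by blast
      have "gasket_map l (\<epsilon> n) y \<in> S" if "y \<in> S" for n y
        using S that codesD[OF \<epsilon>(1), of n] by blast
      then have in_S: "address_map l \<epsilon> n y \<in> S" if "y \<in> S" for n y
        using that by (induction n arbitrary: y) auto
      have "(\<lambda>n. address_map l \<epsilon> n z) \<longlonglongrightarrow> x"
        unfolding \<epsilon>(2) by (rule address_map_tendsto) simp
      moreover have "closed S"
        using S by (intro compact_imp_closed) blast
      ultimately show "x \<in> S"
        using closed_sequentially[of S "\<lambda>n. address_map l \<epsilon> n z"] in_S[OF \<open>z \<in> S\<close>] by blast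
    qed
  qed
qed

lemma uniqueness_set_eq: "uniqueness_set l = point l ` unique_codes l"
proof -
  have "(\<exists>!\<epsilon>. \<epsilon> \<in> codes \<and> x = point l \<epsilon>) \<longleftrightarrow> x \<in> point l ` unique_codes l" for x
  proof
    assume "\<exists>!\<epsilon>. \<epsilon> \<in> codes \<and> x = point l \<epsilon>"
    then obtain \<epsilon> where "\<epsilon> \<in> codes" "x = point l \<epsilon>" "\<And>\<eta>. \<eta> \<in> codes \<Longrightarrow> x = point l \<eta> \<Longrightarrow> \<eta> = \<epsilon>"
      by (elim ex1E) blast
    then show "x \<in> point l ` unique_codes l"
      by (intro image_eqI[of _ _ \<epsilon>]) (simp_all add: unique_codes_def)
  next
    assume "x \<in> point l ` unique_codes l"
    then obtain \<epsilon> where "\<epsilon> \<in> unique_codes l" "x = point l \<epsilon>"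
      by (rule imageE)
    then show "\<exists>!\<epsilon>. \<epsilon> \<in> codes \<and> x = point l \<epsilon>"
      by (intro ex1I[of _ \<epsilon>]) (simp_all add: unique_codes_def)
  qed
  moreover have "point l ` unique_codes l \<subseteq> point l ` codes"
    unfolding unique_codes_def by (intro image_mono) simp
  ultimately show ?thesis
    unfolding uniqueness_set_def gasket_eq is_address_iff by blast
qed

lemma unique_codesD: "\<epsilon> \<in> unique_codes l \<Longrightarrow> \<epsilon> \<in> codes"
  by (simp add: unique_codes_def)

lemma tail_unique_codes:
  assumes "\<epsilon> \<in> unique_codes l"
  shows "tail n \<epsilon> \<in> unique_codes l"
proof (induction n)
  case 0
  show ?case
    using assms by simp
next
  case (Suc n)
  let ?\<eta> = "tail n \<epsilon>"
  have \<eta>: "?\<eta> \<in> codes" "\<And>\<epsilon>'. \<epsilon>' \<in> codes \<Longrightarrow> point l \<epsilon>' = point l ?\<eta> \<Longrightarrow> \<epsilon>' = ?\<eta>"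
    using Suc by (auto simp: unique_codes_def)
  have "\<epsilon>' = tail 1 ?\<eta>" if "\<epsilon>' \<in> codes" "point l \<epsilon>' = point l (tail 1 ?\<eta>)" for \<epsilon>'
  proof -
    have "point l (case_nat (?\<eta> 0) \<epsilon>') = point l ?\<eta>"
      using that point_tail[of ?\<eta>] by (simp add: point_case_nat)
    then have "case_nat (?\<eta> 0) \<epsilon>' = ?\<eta>"
      using \<eta>(2) case_nat_codes[OF codesD[OF \<eta>(1), of 0] that(1)] by blast
    then show ?thesis
      using tail_case_nat[of 0 "?\<eta> 0" \<epsilon>'] by simp
  qed
  then show ?case
    using tail_codes[OF \<eta>(1), of 1] by (auto simp: unique_codes_def)
qed

lemma le_0_geometricI:
  fixes x :: real
  assumes "\<And>n. x \<le> l ^ n"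
  shows "x \<le> 0"
  using assms l_pos l_less_1 by (intro LIMSEQ_le_const[OF LIMSEQ_power_zero[of l]]) auto

text \<open>A side of the triangle is covered by two of its contracted copies, so all of it belongs to
  the gasket, and its points have addresses without the opposite digit. The address is produced
  by the greedy algorithm on the barycentric coordinate.\<close>

lemma edge_point_address:
  assumes "1 / 2 \<le> l" "0 \<le> t" "t \<le> 1" and ik: "i \<in> {0, 1, 2}" "k \<in> {0, 1, 2}" "i \<noteq> k"
  shows "\<exists>\<epsilon>\<in>codes. (\<forall>n. \<epsilon> n \<in> {i, k}) \<and> bary i (point l \<epsilon>) = t"
proof -
  define r where "r n = ((\<lambda>x. if x \<le> l then x / l else (x - (1 - l)) / l) ^^ n) t" for n
  define \<epsilon> where "\<epsilon> n = (if r n \<le> l then k else i)" for n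
  have r_Suc: "r (Suc n) = (if r n \<le> l then r n / l else (r n - (1 - l)) / l)" for n
    by (simp add: r_def)
  have r_bounds: "0 \<le> r n \<and> r n \<le> 1" for n
  proof (induction n)
    case 0
    then show ?case
      using assms by (simp add: r_def)
  next
    case (Suc n)
    then show ?case
      unfolding r_Suc using l_pos assms(1) by (auto simp: field_simps)
  qed
  have \<epsilon>: "\<epsilon> \<in> codes"
    using ik by (simp add: codes_def \<epsilon>_def)
  have err: "bary i (point l \<epsilon>) - t = l ^ n * (bary i (point l (tail n \<epsilon>)) - r n)" for n
  proof (induction n)
    case 0
    show ?case
      by (simp add: r_def)
  next
    case (Suc n)
    have "l * r (Suc n) = (if r n \<le> l then r n else r n - (1 - l))"
      using l_pos by (simp add: r_Suc)
    then have "bary i (point l (tail n \<epsilon>)) - r n = l * (bary i (point l (tail (Suc n) \<epsilon>)) - r (Suc n))"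
      using bary_point_tail[OF tail_codes[OF \<epsilon>, of n] ik(1)] ik(3)
      by (cases "r n \<le> l") (simp_all add: \<epsilon>_def right_diff_distrib)
    then show ?case
      using Suc by simp
  qed
  have "\<bar>bary i (point l \<epsilon>) - t\<bar> \<le> l ^ n" for n
  proof -
    have "\<bar>bary i (point l (tail n \<epsilon>)) - r n\<bar> \<le> 1"
      using bary_point_nonneg[OF tail_codes[OF \<epsilon>, of n] ik(1)]
        bary_point_le_1[OF tail_codes[OF \<epsilon>, of n] ik(1)] r_bounds[of n] by linarith
    then show ?thesis
      unfolding err[of n] abs_mult using l_pos by (simp add: mult_left_le)
  qed
  then have "\<bar>bary i (point l \<epsilon>) - t\<bar> \<le> 0"
    by (rule le_0_geometricI)
  then show ?thesis
    using \<epsilon> by (intro bexI[of _ \<epsilon>]) (auto simp: \<epsilon>_def)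
qed

end

section \<open>Which addresses are unique\<close>

definition begins_with_run :: "nat \<Rightarrow> nat \<Rightarrow> (nat \<Rightarrow> nat) \<Rightarrow> bool" where
  "begins_with_run j n \<epsilon> \<longleftrightarrow> (\<forall>i<n. \<epsilon> i = j)"

text \<open>The condition on a sequence that continues a run of \<open>k\<close> digits \<open>a\<close>; the case \<open>k = 0\<close>
  stands for a run of \<open>a\<close> that started at the very beginning, which may be arbitrarily long.\<close>

definition follows :: "nat \<Rightarrow> nat \<Rightarrow> nat \<Rightarrow> (nat \<Rightarrow> nat) \<Rightarrow> bool" where
  "follows m a k \<epsilon> \<longleftrightarrow>
     (\<forall>j. j \<noteq> a \<longrightarrow> \<not> begins_with_run j m \<epsilon>) \<and> (k \<noteq> 0 \<longrightarrow> \<not> begins_with_run a (m - k) \<epsilon>)"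

definition admissible :: "nat \<Rightarrow> (nat \<Rightarrow> nat) \<Rightarrow> bool" where
  "admissible m \<epsilon> \<longleftrightarrow> (\<forall>n. follows m (\<epsilon> n) 0 (tail (Suc n) \<epsilon>))"

lemma admissible_tail: "admissible m \<epsilon> \<Longrightarrow> admissible m (tail n \<epsilon>)"
  by (simp add: admissible_def tail_apply)

locale multinacci_ratio = ratio +
  fixes m :: nat
  assumes m_ge_2: "2 \<le> m" and l_power: "l ^ Suc m = 2 * l - 1"
begin

lemma half_less_l: "1 / 2 < l"
  using zero_less_power[OF l_pos, of "Suc m"] unfolding l_power by simp

lemma power_ge: "n \<le> Suc m \<Longrightarrow> 2 * l - 1 \<le> l ^ n"
  unfolding l_power[symmetric] using l_pos l_less_1 by (intro power_decreasing) auto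

text \<open>How the deficit \<open>1 - l - bary j\<close> passes from one position with a digit other than \<open>j\<close>
  to the next one: the run of \<open>j\<close> in between is too short to change its sign.\<close>

lemma deficit_step:
  assumes \<epsilon>: "\<epsilon> \<in> codes" "j \<in> {0, 1, 2}" "\<epsilon> 0 \<noteq> j" "\<not> begins_with_run j m (tail 1 \<epsilon>)"
  shows "\<exists>k<m. (\<forall>i<k. \<epsilon> (Suc i) = j) \<and> \<epsilon> (Suc k) \<noteq> j \<and>
    l ^ Suc k * (1 - l - bary j (point l (tail (Suc k) \<epsilon>))) \<le> 1 - l - bary j (point l \<epsilon>)"
proof -
  obtain i where i: "i < m" "\<epsilon> (Suc i) \<noteq> j"
    using assms(4) by (auto simp: begins_with_run_def tail_apply)
  define k where "k = (LEAST i. \<epsilon> (Suc i) \<noteq> j)"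
  have k: "\<epsilon> (Suc k) \<noteq> j" "k < m"
    using LeastI[of "\<lambda>i. \<epsilon> (Suc i) \<noteq> j", OF i(2)]
      Least_le[of "\<lambda>i. \<epsilon> (Suc i) \<noteq> j", OF i(2)] i(1) unfolding k_def by linarith+
  have k': "\<epsilon> (Suc i) = j" if "i < k" for i
    using not_less_Least[of i "\<lambda>i. \<epsilon> (Suc i) \<noteq> j"] that unfolding k_def by blast
  let ?b = "bary j (point l (tail (Suc k) \<epsilon>))"
  have "bary j (point l \<epsilon>) = l * bary j (point l (tail 1 \<epsilon>))"
    using bary_point_tail[OF \<epsilon>(1,2)] \<epsilon>(3) by simp
  also have "bary j (point l (tail 1 \<epsilon>)) = 1 - l ^ k * (1 - ?b)"
    using bary_prefix_constant[OF tail_codes[OF \<epsilon>(1), of 1] \<epsilon>(2), of k] k'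
    by (simp add: tail_apply)
  finally have "1 - l - bary j (point l \<epsilon>) - l ^ Suc k * (1 - l - ?b) = l ^ Suc (Suc k) - (2 * l - 1)"
    by (simp add: algebra_simps)
  moreover have "2 * l - 1 \<le> l ^ Suc (Suc k)"
    using k(2) by (intro power_ge) simp
  ultimately have "l ^ Suc k * (1 - l - ?b) \<le> 1 - l - bary j (point l \<epsilon>)"
    by linarith
  then show ?thesis
    using k k' by blast
qed

lemma admissible_not_begins:
  assumes "admissible m \<epsilon>" "\<epsilon> n \<noteq> j"
  shows "\<not> begins_with_run j m (tail (Suc n) \<epsilon>)"
  using assms by (auto simp: admissible_def follows_def)

text \<open>Iterating the previous lemma multiplies a possible violation by a power of \<open>l\<close>, while the
  violation cannot exceed 1 to begin with.\<close>

lemma admissible_bary_le: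
  assumes \<epsilon>: "\<epsilon> \<in> codes" "admissible m \<epsilon>" "j \<in> {0, 1, 2}" "\<epsilon> 0 \<noteq> j"
  shows "bary j (point l \<epsilon>) \<le> 1 - l"
proof -
  have "bary j (point l \<epsilon>) - (1 - l) \<le> l ^ n" for n
    using \<epsilon>
  proof (induction n arbitrary: \<epsilon>)
    case 0
    then show ?case
      using bary_point_le_1[of \<epsilon> j] l_less_1 by simp
  next
    case (Suc n)
    obtain k where k: "\<epsilon> (Suc k) \<noteq> j"
      "l ^ Suc k * (1 - l - bary j (point l (tail (Suc k) \<epsilon>))) \<le> 1 - l - bary j (point l \<epsilon>)"
      using deficit_step[OF Suc.prems(1,3,4)] admissible_not_begins[OF Suc.prems(2,4)] by auto
    have "bary j (point l (tail (Suc k) \<epsilon>)) - (1 - l) \<le> l ^ n"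
      using k(1) Suc.prems by (intro Suc.IH) (simp_all add: tail_codes admissible_tail)
    then have "l ^ Suc k * (bary j (point l (tail (Suc k) \<epsilon>)) - (1 - l)) \<le> l ^ Suc k * l ^ n"
      using l_pos by (intro mult_left_mono) auto
    also have "\<dots> = l ^ Suc n * l ^ k"
      by simp
    also have "\<dots> \<le> l ^ Suc n"
      using l_pos l_less_1 by (intro mult_left_le) (auto simp: power_le_one)
    finally show ?case
      using k(2) by (simp add: right_diff_distrib)
  qed
  then have "bary j (point l \<epsilon>) - (1 - l) \<le> 0"
    by (rule le_0_geometricI)
  then show ?thesis
    by simp
qed

text \<open>The defining equation of the multinacci number amounts to \<open>f_i f_j ^ m = f_j f_i ^ m\<close>, so a
  word \<open>i j ^ m\<close> in an address can be exchanged for \<open>j i ^ m\<close>.\<close>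

lemma unique_codes_not_begins:
  assumes \<epsilon>: "\<epsilon> \<in> unique_codes l" "\<epsilon> 0 \<noteq> j" "j \<in> {0, 1, 2}"
  shows "\<not> begins_with_run j m (tail 1 \<epsilon>)"
proof
  assume "begins_with_run j m (tail 1 \<epsilon>)"
  then have run: "\<epsilon> (Suc i) = j" if "i < m" for i
    using that by (simp add: begins_with_run_def tail_apply)
  let ?i = "\<epsilon> 0"
  define \<eta> where "\<eta> n = (if n = 0 then j else if n \<le> m then ?i else \<epsilon> n)" for n
  have codes: "\<epsilon> \<in> codes" "\<eta> \<in> codes"
    using unique_codesD[OF \<epsilon>(1)] \<epsilon>(3) by (auto simp: codes_def \<eta>_def)
  have tails: "tail (Suc m) \<eta> = tail (Suc m) \<epsilon>"
    by (simp add: tail_def \<eta>_def)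
  have swap: "bary a (point l \<zeta>) = 1 - l + l ^ Suc m * bary a (point l (tail (Suc m) \<zeta>))"
    "bary b (point l \<zeta>) = 1 - l + l ^ Suc m * bary b (point l (tail (Suc m) \<zeta>))"
    if "\<zeta> \<in> codes" "a \<in> {0, 1, 2}" "b \<in> {0, 1, 2}" "a \<noteq> b" "\<zeta> 0 = a" "\<And>i. i < m \<Longrightarrow> \<zeta> (Suc i) = b"
    for \<zeta> a b
  proof -
    have "bary a (point l (tail 1 \<zeta>)) = l ^ m * bary a (point l (tail (Suc m) \<zeta>))"
      using bary_prefix_avoiding[OF tail_codes[OF that(1), of 1] that(2), of m] that
      by (simp add: tail_apply)
    then show "bary a (point l \<zeta>) = 1 - l + l ^ Suc m * bary a (point l (tail (Suc m) \<zeta>))"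
      using bary_point_tail[OF that(1,2)] that by simp
    have "bary b (point l (tail 1 \<zeta>)) = 1 - l ^ m * (1 - bary b (point l (tail (Suc m) \<zeta>)))"
      using bary_prefix_constant[OF tail_codes[OF that(1), of 1] that(3), of m] that
      by (simp add: tail_apply)
    then have "bary b (point l \<zeta>) = l - l ^ Suc m + l ^ Suc m * bary b (point l (tail (Suc m) \<zeta>))"
      using bary_point_tail[OF that(1,3)] that by (simp add: right_diff_distrib)
    then show "bary b (point l \<zeta>) = 1 - l + l ^ Suc m * bary b (point l (tail (Suc m) \<zeta>))"
      using l_power by linarith
  qed
  have "point l \<eta> = point l \<epsilon>"
  proof (rule bary_eqI)
    fix r :: nat
    assume r: "r \<in> {0, 1, 2}"
    consider "r = ?i" | "r = j" | "r \<noteq> ?i" "r \<noteq> j"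
      by blast
    then show "bary r (point l \<eta>) = bary r (point l \<epsilon>)"
    proof cases
      case 3
      have "\<epsilon> i \<noteq> r \<and> \<eta> i \<noteq> r" if "i < Suc m" for i
        using 3 that run by (cases i) (auto simp: \<eta>_def)
      then show ?thesis
        using bary_prefix_avoiding[OF codes(1) r, of "Suc m"]
          bary_prefix_avoiding[OF codes(2) r, of "Suc m"] tails by simp
    qed (use swap[of \<epsilon> ?i j] swap[of \<eta> j ?i] codes run \<epsilon> tails codesD[OF codes(1), of 0]
        in \<open>simp_all add: \<eta>_def\<close>)
  qed
  then have "\<eta> = \<epsilon>"
    using \<epsilon>(1) codes by (simp add: unique_codes_def)
  then show False
    using \<epsilon>(2) by (metis \<eta>_def)
qed

lemma unique_codes_admissible:
  assumes "\<epsilon> \<in> unique_codes l"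
  shows "admissible m \<epsilon>"
  unfolding admissible_def follows_def
proof (intro allI conjI impI)
  fix n j
  assume "j \<noteq> \<epsilon> n"
  show "\<not> begins_with_run j m (tail (Suc n) \<epsilon>)"
  proof (cases "j \<in> {0, 1, 2}")
    case True
    then show ?thesis
      using unique_codes_not_begins[OF tail_unique_codes[OF assms, of n], of j] \<open>j \<noteq> \<epsilon> n\<close> by simp
  next
    case False
    then show ?thesis
      using codesD[OF unique_codesD[OF assms], of "Suc n"] m_ge_2
      unfolding begins_with_run_def by (metis tail_hd less_le_trans zero_less_numeral)
  qed
qed simp

text \<open>If equality holds in \<open>admissible_bary_le\<close>, the point also lies in the contracted copy of the
  triangle at the vertex \<open>j\<close>, on the side of this copy that faces away from \<open>j\<close>. All points of
  this side have addresses that start with \<open>j\<close>, so equality costs uniqueness.\<close>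

lemma unique_codes_bary_less:
  assumes \<epsilon>: "\<epsilon> \<in> unique_codes l" "j \<in> {0, 1, 2}" "\<epsilon> 0 \<noteq> j"
  shows "bary j (point l \<epsilon>) < 1 - l"
proof (rule ccontr)
  let ?x = "point l \<epsilon>"
  let ?i = "\<epsilon> 0"
  assume "\<not> bary j ?x < 1 - l"
  then have j: "bary j ?x = 1 - l"
    using admissible_bary_le[OF unique_codesD unique_codes_admissible] \<epsilon> by fastforce
  have codes: "\<epsilon> \<in> codes"
    using \<epsilon>(1) by (rule unique_codesD)
  have i: "?i \<in> {0, 1, 2}"
    using codes by (rule codesD)
  define k where "k = 3 - (?i + j)"
  have k: "k \<in> {0, 1, 2}" "?i \<noteq> k" "j \<noteq> k" "\<And>r. r \<in> {0, 1, 2} \<Longrightarrow> r = ?i \<or> r = j \<or> r = k"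
    using i \<epsilon>(2,3) unfolding k_def by auto
  have total: "bary ?i y + bary j y + bary k y = 1" for y
    using i \<epsilon>(2,3) sum_bary[of y] unfolding k_def by (elim insertE emptyE) simp_all
  have "0 \<le> bary ?i ?x / l" "bary ?i ?x / l \<le> 1"
    using bary_point_nonneg[OF codes i] bary_point_nonneg[OF codes k(1)] total[of ?x] j l_pos
    by auto
  then obtain \<eta> where \<eta>: "\<eta> \<in> codes" "\<And>n. \<eta> n \<in> {?i, k}" "bary ?i (point l \<eta>) = bary ?i ?x / l"
    using edge_point_address[OF less_imp_le[OF half_less_l] _ _ i k(1,2)] by blast
  let ?y = "point l (case_nat j \<eta>)"
  have y: "case_nat j \<eta> \<in> codes"
    using \<epsilon>(2) \<eta>(1) by (rule case_nat_codes)
  have "\<eta> n \<noteq> j" for n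
    using \<eta>(2)[of n] k(3) \<epsilon>(3) by (metis insert_iff singletonD)
  then have "bary j (point l \<eta>) \<le> l ^ n" for n
    using bary_prefix_avoiding[OF \<eta>(1) \<epsilon>(2), of n] l_pos
      bary_point_le_1[OF tail_codes[OF \<eta>(1), of n] \<epsilon>(2)] by (simp add: mult_left_le)
  then have "bary j (point l \<eta>) = 0"
    using le_0_geometricI bary_point_nonneg[OF \<eta>(1) \<epsilon>(2)] by fastforce
  then have yj: "bary j ?y = bary j ?x"
    unfolding point_case_nat bary_gasket_map[OF \<epsilon>(2,2)] j by simp
  moreover have yi: "bary ?i ?y = bary ?i ?x"
    unfolding point_case_nat bary_gasket_map[OF \<epsilon>(2) i] \<eta>(3) using \<epsilon>(3) l_pos by simp
  moreover have "bary k ?y = bary k ?x"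
    using total[of ?x] total[of ?y] yi yj by linarith
  ultimately have "?y = ?x"
    using k(4) by (metis bary_eqI)
  then have "case_nat j \<eta> = \<epsilon>"
    using \<epsilon>(1) y by (simp add: unique_codes_def)
  then show False
    using \<epsilon>(3) by (metis nat.case(1))
qed

text \<open>A digit may be put in front of a unique address unless the result starts with \<open>i j ^ m\<close>.
  Indeed a second address of the new point would have to start with another digit \<open>j\<close>, which
  forces its \<open>j\<close>-th coordinate up to \<open>1 - l\<close>.\<close>

lemma unique_codes_step:
  assumes \<epsilon>: "\<epsilon> \<in> codes" and tail: "tail 1 \<epsilon> \<in> unique_codes l"
  shows "\<epsilon> \<in> unique_codes l \<longleftrightarrow> follows m (\<epsilon> 0) 0 (tail 1 \<epsilon>)"
proof
  assume "\<epsilon> \<in> unique_codes l"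
  then show "follows m (\<epsilon> 0) 0 (tail 1 \<epsilon>)"
    using unique_codes_admissible by (simp add: admissible_def)
next
  assume follows: "follows m (\<epsilon> 0) 0 (tail 1 \<epsilon>)"
  have "\<eta> = \<epsilon>" if \<eta>: "\<eta> \<in> codes" "point l \<eta> = point l \<epsilon>" for \<eta>
  proof (cases "\<eta> 0 = \<epsilon> 0")
    case True
    then have "point l (tail 1 \<eta>) = point l (tail 1 \<epsilon>)"
      using point_tail[of \<epsilon>] point_tail[of \<eta>] \<eta>(2) by (simp add: gasket_map_eq_iff)
    then have "tail 1 \<eta> = tail 1 \<epsilon>"
      using tail tail_codes[OF \<eta>(1)] by (simp add: unique_codes_def)
    then show ?thesis
      using True by (metis case_nat_tail One_nat_def)
  next
    case False
    let ?j = "\<eta> 0"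
    have j: "?j \<in> {0, 1, 2}"
      using \<eta>(1) by (rule codesD)
    obtain k where k: "\<epsilon> (Suc k) \<noteq> ?j"
      "l ^ Suc k * (1 - l - bary ?j (point l (tail (Suc k) \<epsilon>))) \<le> 1 - l - bary ?j (point l \<epsilon>)"
      using deficit_step[OF \<epsilon> j] follows False by (auto simp: follows_def)
    have "tail (Suc k) \<epsilon> \<in> unique_codes l"
      using tail_unique_codes[OF tail, of k] by simp
    then have "0 < 1 - l - bary ?j (point l (tail (Suc k) \<epsilon>))"
      using unique_codes_bary_less[of "tail (Suc k) \<epsilon>" ?j] j k(1) by simp
    then have "0 < 1 - l - bary ?j (point l \<epsilon>)"
      using k(2) l_pos by (meson less_le_trans mult_pos_pos zero_less_power)
    moreover have "1 - l \<le> bary ?j (point l \<eta>)"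
      using bary_point_tail[OF \<eta>(1) j] bary_point_nonneg[OF tail_codes[OF \<eta>(1)] j, of 1] l_pos
      by simp
    ultimately show ?thesis
      using \<eta>(2) by simp
  qed
  then show "\<epsilon> \<in> unique_codes l"
    using \<epsilon> by (simp add: unique_codes_def)
qed

text \<open>A quantitative form of \<open>unique_codes_bary_less\<close>: two consecutive digits other than \<open>j\<close> keep
  the \<open>j\<close>-th coordinate a definite amount below \<open>1 - l\<close>.\<close>

lemma admissible_bary_gap:
  assumes "\<epsilon> \<in> codes" "admissible m \<epsilon>" "j \<in> {0, 1, 2}"
    and "\<epsilon> 0 \<noteq> j" "\<epsilon> n \<noteq> j" "\<epsilon> (Suc n) \<noteq> j"
  shows "l ^ n * (1 - l)\<^sup>2 \<le> 1 - l - bary j (point l \<epsilon>)"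
  using assms
proof (induction n arbitrary: \<epsilon> rule: less_induct)
  case (less n)
  show ?case
  proof (cases "n = 0")
    case True
    have "bary j (point l \<epsilon>) = l * bary j (point l (tail 1 \<epsilon>))"
      using bary_point_tail[OF less.prems(1,3)] less.prems(4) by simp
    also have "\<dots> \<le> l * (1 - l)"
      using admissible_bary_le[of "tail 1 \<epsilon>" j] less.prems True l_pos
      by (intro mult_left_mono) (simp_all add: tail_codes admissible_tail)
    finally show ?thesis
      using True by (simp add: power2_eq_square algebra_simps)
  next
    case False
    obtain k where k: "\<And>i. i < k \<Longrightarrow> \<epsilon> (Suc i) = j" "\<epsilon> (Suc k) \<noteq> j"
      "l ^ Suc k * (1 - l - bary j (point l (tail (Suc k) \<epsilon>))) \<le> 1 - l - bary j (point l \<epsilon>)"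
      using deficit_step[OF less.prems(1,3,4)] admissible_not_begins[OF less.prems(2,4)] by auto
    have "Suc k \<le> n"
    proof (rule ccontr)
      assume "\<not> Suc k \<le> n"
      then show False
        using k(1)[of "n - 1"] False less.prems(5) by (cases n) simp_all
    qed
    then have "l ^ (n - Suc k) * (1 - l)\<^sup>2 \<le> 1 - l - bary j (point l (tail (Suc k) \<epsilon>))"
      using less.prems k(2) by (intro less.IH) (simp_all add: tail_codes admissible_tail, simp_all add: tail_apply)
    then have "l ^ Suc k * (l ^ (n - Suc k) * (1 - l)\<^sup>2)
        \<le> l ^ Suc k * (1 - l - bary j (point l (tail (Suc k) \<epsilon>)))"
      using l_pos by (intro mult_left_mono) auto
    moreover have "l ^ Suc k * (l ^ (n - Suc k) * (1 - l)\<^sup>2) = l ^ n * (1 - l)\<^sup>2"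
      using \<open>Suc k \<le> n\<close> by (simp only: mult.assoc[symmetric] power_add[symmetric]) simp
    ultimately show ?thesis
      using k(3) by linarith
  qed
qed

text \<open>The gap of \<open>admissible_bary_gap\<close> is then bounded below at every position of the sequence by
  the same constant.\<close>

definition spread :: "nat \<Rightarrow> (nat \<Rightarrow> nat) \<Rightarrow> bool" where
  "spread P \<epsilon> \<longleftrightarrow> (\<forall>j\<in>{0, 1, 2}. \<forall>n. \<exists>p\<in>{n..n + P}. \<epsilon> p \<noteq> j \<and> \<epsilon> (Suc p) \<noteq> j)"

text \<open>Where the two addresses part, the coordinate that belongs to the next digit of the second one
  is at least \<open>1 - l\<close> for the second point and stays below by a definite amount for the first.\<close>

lemma spread_separation:
  assumes \<epsilon>: "\<epsilon> \<in> codes" "admissible m \<epsilon>" "spread P \<epsilon>" and \<eta>: "\<eta> \<in> codes"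
    and diff: "\<epsilon> n \<noteq> \<eta> n" "\<And>i. i < n \<Longrightarrow> \<epsilon> i = \<eta> i"
  shows "l ^ (n + P) * (1 - l)\<^sup>2 \<le> dist (point l \<epsilon>) (point l \<eta>)"
proof -
  let ?\<epsilon> = "tail n \<epsilon>" and ?\<eta> = "tail n \<eta>"
  let ?j = "\<eta> n"
  have j: "?j \<in> {0, 1, 2}"
    using \<eta> by (rule codesD)
  obtain p where p: "p \<in> {n..n + P}" "\<epsilon> p \<noteq> ?j" "\<epsilon> (Suc p) \<noteq> ?j"
    using \<epsilon>(3) j unfolding spread_def by blast
  have "l ^ P * (1 - l)\<^sup>2 \<le> l ^ (p - n) * (1 - l)\<^sup>2"
    using p(1) l_pos l_less_1 by (intro mult_right_mono power_decreasing) auto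
  also have "\<dots> \<le> 1 - l - bary ?j (point l ?\<epsilon>)"
    using p diff(1) \<epsilon> j
    by (intro admissible_bary_gap) (simp_all add: tail_codes admissible_tail tail_apply)
  also have "1 - l \<le> bary ?j (point l ?\<eta>)"
    using bary_point_tail[OF tail_codes[OF \<eta>, of n] j]
      bary_point_nonneg[OF tail_codes[OF \<eta>] j, of "n + 1"] l_pos by simp
  finally have "l ^ P * (1 - l)\<^sup>2 \<le> bary ?j (point l ?\<eta>) - bary ?j (point l ?\<epsilon>)"
    by simp
  also have "\<dots> \<le> dist (point l ?\<epsilon>) (point l ?\<eta>)"
    using bary_dist[of ?j "point l ?\<epsilon>" "point l ?\<eta>"] by linarith
  finally have "l ^ n * (l ^ P * (1 - l)\<^sup>2) \<le> l ^ n * dist (point l ?\<epsilon>) (point l ?\<eta>)"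
    using l_pos by (intro mult_left_mono) auto
  then show ?thesis
    using dist_point_prefix[of n \<epsilon> \<eta>] diff(2) by (simp add: power_add mult.assoc)
qed

lemma spread_unique:
  assumes \<epsilon>: "\<epsilon> \<in> codes" "admissible m \<epsilon>" "spread P \<epsilon>"
  shows "\<epsilon> \<in> unique_codes l"
proof -
  have "\<eta> = \<epsilon>" if \<eta>: "\<eta> \<in> codes" "point l \<eta> = point l \<epsilon>" for \<eta>
  proof (rule ccontr)
    assume "\<eta> \<noteq> \<epsilon>"
    then obtain n where n: "\<epsilon> n \<noteq> \<eta> n" "\<And>i. i < n \<Longrightarrow> \<epsilon> i = \<eta> i"
      using exists_least_iff[of "\<lambda>n. \<epsilon> n \<noteq> \<eta> n"] by fastforce
    have "0 < l ^ (n + P) * (1 - l)\<^sup>2"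
      using l_pos l_less_1 by simp
    then show False
      using spread_separation[OF \<epsilon> \<eta>(1) n] \<eta>(2) by simp
  qed
  then show ?thesis
    using \<epsilon>(1) by (simp add: unique_codes_def)
qed

end

lemma begins_with_run_0 [simp]: "begins_with_run j 0 \<epsilon>"
  by (simp add: begins_with_run_def)

lemma begins_with_run_Suc:
  "begins_with_run j (Suc n) \<epsilon> \<longleftrightarrow> \<epsilon> 0 = j \<and> begins_with_run j n (tail 1 \<epsilon>)"
  by (auto simp: begins_with_run_def tail_apply All_less_Suc2)

section \<open>The automaton of runs\<close>

text \<open>Reading the digit \<open>b\<close> after a run of \<open>k\<close> digits \<open>a\<close>; as in \<open>follows\<close>, \<open>k = 0\<close> stands
  for the initial run, whose length does not matter.\<close>

definition run_next :: "nat \<Rightarrow> nat \<Rightarrow> nat \<Rightarrow> nat" where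
  "run_next a k b = (if b \<noteq> a then 1 else if k = 0 then 0 else Suc k)"

text \<open>The transition of the automaton, in a form that also records the constraint which the first
  digit itself imposes on the rest.\<close>

lemma follows_step:
  assumes "2 \<le> m" "k < m"
  shows "follows m a k \<epsilon> \<and> follows m (\<epsilon> 0) 0 (tail 1 \<epsilon>) \<longleftrightarrow>
    run_next a k (\<epsilon> 0) < m \<and> follows m (\<epsilon> 0) (run_next a k (\<epsilon> 0)) (tail 1 \<epsilon>)"
proof -
  obtain n where m: "m = Suc n"
    using assms by (cases m) auto
  obtain r where r: "m - k = Suc r" "r = m - Suc k"
    using assms by (cases "m - k") auto
  show ?thesis
  proof (cases "\<epsilon> 0 = a")
    case True
    then have "follows m a k \<epsilon> \<longleftrightarrow> k = 0 \<or> \<not> begins_with_run a r (tail 1 \<epsilon>)"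
      unfolding follows_def r(1) unfolding m by (auto simp: begins_with_run_Suc)
    moreover have "r = 0 \<longleftrightarrow> \<not> Suc k < m"
      using r assms by auto
    ultimately show ?thesis
      using True assms r(2) by (auto simp: run_next_def follows_def)
  next
    case False
    then have "follows m a k \<epsilon> \<longleftrightarrow> \<not> begins_with_run (\<epsilon> 0) n (tail 1 \<epsilon>)"
      unfolding follows_def r(1) unfolding m by (auto simp: begins_with_run_Suc)
    then show ?thesis
      using False assms m by (auto simp: run_next_def follows_def)
  qed
qed

section \<open>Self-similarity\<close>

lemma self_similarI:
  fixes V :: "'v::countable set" and K :: "'v \<Rightarrow> 'a::metric_space set"
  assumes fin: "finite V" "finite E"
    and E: "\<And>u g t. (u, g, t) \<in> E \<Longrightarrow> u \<in> V \<and> t \<in> V \<and> contracting_similarity g"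
    and K: "\<And>u. u \<in> V \<Longrightarrow> K u \<noteq> {} \<and> bounded (K u)"
    and inv: "graph_invariant V E K" and u: "u \<in> V"
  shows "self_similar (K u)"
  unfolding self_similar_def
proof (intro exI conjI)
  let ?n = "to_nat :: 'v \<Rightarrow> nat"
  let ?E = "(\<lambda>(u, g, t). (?n u, g, ?n t)) ` E"
  show "finite (?n ` V)" "finite ?E"
    using fin by simp_all
  show "\<forall>(u, g, t)\<in>?E. u \<in> ?n ` V \<and> t \<in> ?n ` V \<and> contracting_similarity g"
    using E by auto
  show "\<forall>u\<in>?n ` V. (K \<circ> from_nat) u \<noteq> {} \<and> bounded ((K \<circ> from_nat) u)"
    using K by simp
  show "graph_invariant (?n ` V) ?E (K \<circ> from_nat)"
    unfolding graph_invariant_def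
  proof (intro ballI, elim imageE)
    fix u' u
    assume u: "u' = ?n u" "u \<in> V"
    have "{(g, t). (u', g, t) \<in> ?E} = (\<lambda>(g, t). (g, ?n t)) ` {(g, t). (u, g, t) \<in> E}"
      using u(1) by force
    then have "(\<Union>(g, t)\<in>{(g, t). (u', g, t) \<in> ?E}. g ` (K \<circ> from_nat) t)
        = (\<Union>(g, t)\<in>{(g, t). (u, g, t) \<in> E}. g ` K t)"
      by (simp add: image_image case_prod_beta)
    then show "(K \<circ> from_nat) u' = (\<Union>(g, t)\<in>{(g, t). (u', g, t) \<in> ?E}. g ` (K \<circ> from_nat) t)"
      using inv u by (simp add: graph_invariant_def)
  qed
  show "\<exists>v\<in>?n ` V. K u = (K \<circ> from_nat) v"
    using u by (intro bexI[of _ "?n u"]) simp_all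
qed

context ratio
begin

lemma point_image_step:
  assumes "A \<subseteq> codes" "\<And>b. F b \<subseteq> codes" "B \<subseteq> {0, 1, 2}"
    and "\<And>\<epsilon>. \<epsilon> \<in> codes \<Longrightarrow> \<epsilon> \<in> A \<longleftrightarrow> \<epsilon> 0 \<in> B \<and> tail 1 \<epsilon> \<in> F (\<epsilon> 0)"
  shows "point l ` A = (\<Union>b\<in>B. gasket_map l b ` point l ` F b)"
proof (intro set_eqI iffI)
  fix x
  assume "x \<in> point l ` A"
  then obtain \<epsilon> where \<epsilon>: "\<epsilon> \<in> A" "x = point l \<epsilon>"
    by blast
  then have "\<epsilon> 0 \<in> B" "tail 1 \<epsilon> \<in> F (\<epsilon> 0)"
    using assms(1,4) by blast+
  then show "x \<in> (\<Union>b\<in>B. gasket_map l b ` point l ` F b)"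
    using point_tail[of \<epsilon>] \<epsilon>(2) by blast
next
  fix x
  assume "x \<in> (\<Union>b\<in>B. gasket_map l b ` point l ` F b)"
  then obtain b \<epsilon> where b: "b \<in> B" "\<epsilon> \<in> F b" "x = point l (case_nat b \<epsilon>)"
    unfolding point_case_nat by blast
  then have "case_nat b \<epsilon> \<in> codes"
    using assms(2,3) by (intro case_nat_codes) auto
  then have "case_nat b \<epsilon> \<in> A"
    using assms(4) b by simp
  then show "x \<in> point l ` A"
    using b(3) by blast
qed

end

context multinacci_ratio
begin

lemma unique_codes_iff:
  assumes "\<epsilon> \<in> codes"
  shows "\<epsilon> \<in> unique_codes l \<longleftrightarrow> tail 1 \<epsilon> \<in> unique_codes l \<and> follows m (\<epsilon> 0) 0 (tail 1 \<epsilon>)"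
  using unique_codes_step[OF assms] tail_unique_codes by blast

text \<open>Periodic addresses \<open>0 1 2 0 1 2 \<dots>\<close> provide points with a unique address in every vertex
  of the graph.\<close>

lemma cyclic_code:
  fixes c :: nat
  defines "\<zeta> \<equiv> \<lambda>n. (c + n) mod 3"
  shows "\<zeta> \<in> unique_codes l"
    and "\<lbrakk>a < 3; a \<noteq> c mod 3; k < m\<rbrakk> \<Longrightarrow> follows m a k \<zeta>"
proof -
  have Suc: "\<zeta> (Suc n) = (if \<zeta> n = 2 then 0 else Suc (\<zeta> n))" for n
    by (simp add: \<zeta>_def mod_Suc)
  then have step: "\<zeta> n \<noteq> \<zeta> (Suc n)" for n
    by simp
  have less_3: "\<zeta> n < 3" for n
    by (simp add: \<zeta>_def)
  have no_run: "\<not> begins_with_run j m (tail n \<zeta>)" for j n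
  proof
    assume "begins_with_run j m (tail n \<zeta>)"
    then have "\<zeta> (n + i) = j" if "i < m" for i
      using that by (simp add: begins_with_run_def tail_apply)
    from this[of 0] this[of 1] have "\<zeta> n = j" "\<zeta> (Suc n) = j"
      using m_ge_2 by simp_all
    then show False
      using step[of n] by simp
  qed
  show "follows m a k \<zeta>" if "a < 3" "a \<noteq> c mod 3" "k < m"
  proof -
    have "\<not> begins_with_run a (m - k) \<zeta>"
      unfolding begins_with_run_def \<zeta>_def using that by (metis add_0_right zero_less_diff)
    then show ?thesis
      using no_run[of _ 0] by (simp add: follows_def)
  qed
  have "\<zeta> n \<in> {0, 1, 2}" for n
    using less_3[of n] by auto
  then have "\<zeta> \<in> codes"
    by (simp add: codes_def)
  moreover have "admissible m \<zeta>"
    using no_run by (simp add: admissible_def follows_def)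
  moreover have "spread 2 \<zeta>"
    unfolding spread_def
  proof (intro ballI allI)
    fix j n :: nat
    consider "\<zeta> n \<noteq> j \<and> \<zeta> (Suc n) \<noteq> j" | "\<zeta> n = j" | "\<zeta> (Suc n) = j"
      by blast
    then show "\<exists>p\<in>{n..n + 2}. \<zeta> p \<noteq> j \<and> \<zeta> (Suc p) \<noteq> j"
    proof cases
      case 1
      then show ?thesis
        by (intro bexI[of _ n]) auto
    next
      case 2
      then have "\<zeta> (Suc n) \<noteq> j \<and> \<zeta> (Suc (Suc n)) \<noteq> j"
        using less_3[of n] by (simp add: Suc)
      then show ?thesis
        by (intro bexI[of _ "Suc n"]) auto
    next
      case 3
      then have "\<zeta> (Suc (Suc n)) \<noteq> j \<and> \<zeta> (Suc (Suc (Suc n))) \<noteq> j"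
        using less_3[of "Suc n"] by (simp add: Suc[of "Suc n"] Suc[of "Suc (Suc n)"])
      then show ?thesis
        by (intro bexI[of _ "Suc (Suc n)"]) auto
    qed
  qed
  ultimately show "\<zeta> \<in> unique_codes l"
    by (rule spread_unique)
qed

text \<open>Which unique addresses may follow a given word depends only on the digit and the length of the
  last run of the word, and for the initial run only on the digit. These finitely many possibilities
  are the vertices of the graph, together with \<open>None\<close> for the empty word.\<close>

lemma self_similar_uniqueness_set: "self_similar (uniqueness_set l)"
proof -
  define F where "F v = (case v of None \<Rightarrow> unique_codes l
    | Some (a, k) \<Rightarrow> {\<epsilon> \<in> unique_codes l. follows m a k \<epsilon>})" for v :: "(nat \<times> nat) option"
  define B where "B v = (case v of None \<Rightarrow> {0, 1, 2}
    | Some (a, k) \<Rightarrow> {b \<in> {0, 1, 2}. run_next a k b < m})" for v :: "(nat \<times> nat) option"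
  define nxt where "nxt v b = (case v of None \<Rightarrow> Some (b, 0)
    | Some (a, k) \<Rightarrow> Some (b, run_next a k b))" for v :: "(nat \<times> nat) option" and b :: nat
  define V :: "(nat \<times> nat) option set" where "V = insert None (Some ` ({0, 1, 2} \<times> {..<m}))"
  define E where "E = (\<lambda>(v, b). (v, gasket_map l b, nxt v b)) ` (SIGMA v:V. B v)"
  have B: "B v \<subseteq> {0, 1, 2}" for v
    by (auto simp: B_def split: option.splits)
  have "finite V"
    by (simp add: V_def)
  moreover have "finite (B v)" for v
    using B by (rule finite_subset) simp
  ultimately have "finite E"
    unfolding E_def by blast
  have nxt_V: "nxt v b \<in> V" if "v \<in> V" "b \<in> B v" for v b
    using that m_ge_2 by (auto simp: V_def B_def nxt_def)
  have F_codes: "F v \<subseteq> codes" for v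
    using unique_codesD by (auto simp: F_def split: option.splits)
  have F_step: "\<epsilon> \<in> F v \<longleftrightarrow> \<epsilon> 0 \<in> B v \<and> tail 1 \<epsilon> \<in> F (nxt v (\<epsilon> 0))" if v: "v \<in> V" and \<epsilon>: "\<epsilon> \<in> codes" for \<epsilon> v
  proof (cases v)
    case None
    then show ?thesis
      using unique_codes_iff[OF \<epsilon>] codesD[OF \<epsilon>, of 0] by (simp add: F_def B_def nxt_def)
  next
    case (Some v')
    then obtain a k where ak: "v = Some (a, k)" "k < m"
      using v Some by (auto simp: V_def)
    show ?thesis
      using unique_codes_iff[OF \<epsilon>] follows_step[OF m_ge_2 ak(2), of a \<epsilon>] codesD[OF \<epsilon>, of 0]
      by (auto simp: ak(1) F_def B_def nxt_def)
  qed
  have "self_similar (point l ` F None)"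
  proof (rule self_similarI[where V = V and E = E and K = "\<lambda>v. point l ` F v"])
    show "finite V" "finite E" "None \<in> V"
      by fact+ (simp add: V_def)
    show "u \<in> V \<and> t \<in> V \<and> contracting_similarity g" if "(u, g, t) \<in> E" for u g t
      using that nxt_V contracting_similarity_gasket_map[OF l_pos l_less_1] by (auto simp: E_def)
    show "point l ` F v \<noteq> {} \<and> bounded (point l ` F v)" if v_in: "v \<in> V" for v
    proof
      show "bounded (point l ` F v)"
        unfolding bounded_iff using norm_point_le by blast
      show "point l ` F v \<noteq> {}"
      proof (cases v)
        case None
        then show ?thesis
          using cyclic_code(1) by (auto simp: F_def)
      next
        case (Some v')
        then obtain a k where v: "v = Some (a, k)" "k < m" "a < 3"
          using v_in Some by (auto simp: V_def)
        then have "a \<noteq> Suc a mod 3"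
          by presburger
        then have "(\<lambda>n. (Suc a + n) mod 3) \<in> F v"
          using v cyclic_code(1)[of "Suc a"] cyclic_code(2)[of a "Suc a" k] by (simp add: F_def)
        then show ?thesis
          by blast
      qed
    qed
    show "graph_invariant V E (\<lambda>v. point l ` F v)"
      unfolding graph_invariant_def
    proof
      fix v
      assume v: "v \<in> V"
      have "point l ` F v = (\<Union>b\<in>B v. gasket_map l b ` point l ` F (nxt v b))"
        by (intro point_image_step F_codes B F_step[OF v])
      moreover have "{(g, t). (v, g, t) \<in> E} = (\<lambda>b. (gasket_map l b, nxt v b)) ` B v"
        using v by (auto simp: E_def)
      ultimately show "point l ` F v = (\<Union>(g, t)\<in>{(g, t). (v, g, t) \<in> E}. g ` point l ` F t)"
        by simp
    qed
  qed
  then show ?thesis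
    by (simp add: F_def uniqueness_set_eq)
qed

end

section \<open>Counting admissible words\<close>

fun words :: "nat \<Rightarrow> nat \<Rightarrow> nat \<Rightarrow> nat \<Rightarrow> nat list set" where
  "words m a k 0 = {[]}"
| "words m a k (Suc n) =
    (\<Union>b\<in>{b \<in> {0, 1, 2}. run_next a k b < m}. (#) b ` words m b (run_next a k b) n)"

lemma length_words: "w \<in> words m a k n \<Longrightarrow> length w = n"
  by (induction n arbitrary: a k w) auto

lemma set_words: "w \<in> words m a k n \<Longrightarrow> set w \<subseteq> {0, 1, 2}"
  by (induction n arbitrary: a k w) fastforce+

lemma finite_words [simp]: "finite (words m a k n)"
  by (induction n arbitrary: a k) simp_all

lemma card_words_Suc:
  "card (words m a k (Suc n)) =
    (\<Sum>b\<in>{b \<in> {0, 1, 2}. run_next a k b < m}. card (words m b (run_next a k b) n))"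
  unfolding words.simps by (subst card_UN_disjoint) (auto simp: card_image)

lemma prefix_in_words:
  assumes "2 \<le> m" "\<epsilon> \<in> codes" "admissible m \<epsilon>" "follows m a k \<epsilon>" "k < m"
  shows "map \<epsilon> [0..<n] \<in> words m a k n"
  using assms(2-)
proof (induction n arbitrary: a k \<epsilon>)
  case (Suc n)
  have "follows m (\<epsilon> 0) 0 (tail 1 \<epsilon>)"
    using Suc.prems(2) by (simp add: admissible_def)
  then have step: "run_next a k (\<epsilon> 0) < m" "follows m (\<epsilon> 0) (run_next a k (\<epsilon> 0)) (tail 1 \<epsilon>)"
    using follows_step[OF assms(1) Suc.prems(4)] Suc.prems(3) by blast+
  have "map (tail 1 \<epsilon>) [0..<n] \<in> words m (\<epsilon> 0) (run_next a k (\<epsilon> 0)) n"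
    using Suc.prems step by (intro Suc.IH tail_codes admissible_tail)
  moreover have "map \<epsilon> [0..<Suc n] = \<epsilon> 0 # map (tail 1 \<epsilon>) [0..<n]"
    by (simp only: map_upt_Suc) (simp add: tail_def)
  ultimately show ?case
    using step(1) codesD[OF Suc.prems(1), of 0] by auto
qed simp

locale run_growth =
  fixes s :: real and m :: nat
  assumes s_pos: "0 < s" and s_less_1: "s < 1" and two_le_m: "2 \<le> m"
    and s_sum: "2 * (\<Sum>r = 1..m - 1. s ^ r) = 1"
begin

text \<open>A Perron eigenvector of the automaton for the eigenvalue \<open>1 / s\<close>.\<close>

definition run_weight :: "nat \<Rightarrow> real" where
  "run_weight k = (if k = 0 then 2 * s / (1 - s) else 2 * (\<Sum>r = 1..m - k. s ^ r))"

lemma run_weight_1 [simp]: "run_weight (Suc 0) = 1"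
  using s_sum by (simp add: run_weight_def)

lemma run_weight_m [simp]: "run_weight m = 0"
  using two_le_m by (simp add: run_weight_def)

lemma run_weight_ge: "k < m \<Longrightarrow> 2 * s \<le> run_weight k"
proof (cases "k = 0")
  case True
  have "2 * s * 1 \<le> 2 * s * (1 / (1 - s))"
    using s_pos s_less_1 by (intro mult_left_mono) (simp_all add: le_divide_eq)
  then show ?thesis
    using True by (simp add: run_weight_def)
next
  case False
  assume "k < m"
  have "s ^ 1 \<le> (\<Sum>r = 1..m - k. s ^ r)"
    using \<open>k < m\<close> s_pos by (intro member_le_sum) auto
  then show ?thesis
    using False by (simp add: run_weight_def)
qed

lemma run_weight_le: "run_weight k \<le> 2 * s / (1 - s)"
proof (cases "k = 0")
  case False
  have "(1 - s) * (\<Sum>r = 1..m - k. s ^ r) \<le> s"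
    unfolding geometric_sum_telescope using s_pos by simp
  then have "(\<Sum>r = 1..m - k. s ^ r) \<le> s / (1 - s)"
    using s_less_1 by (simp add: le_divide_eq mult.commute)
  then show ?thesis
    using False by (simp add: run_weight_def)
qed (simp add: run_weight_def)

lemma run_weight_step:
  assumes "a \<in> {0, 1, 2}" "k < m"
  shows "s * (\<Sum>b\<in>{b \<in> {0, 1, 2}. run_next a k b < m}. run_weight (run_next a k b)) = run_weight k"
proof -
  let ?B = "{b \<in> {0, 1, 2}. run_next a k b < m}"
  have vanish: "run_weight (run_next a k b) = 0" if "\<not> run_next a k b < m" for b
  proof -
    have "run_next a k b = m"
      using that assms(2) two_le_m by (auto simp: run_next_def split: if_splits)
    then show ?thesis
      by simp
  qed
  have "(\<Sum>b\<in>?B. run_weight (run_next a k b)) = (\<Sum>b\<in>{0, 1, 2}. run_weight (run_next a k b))"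
    by (intro sum.mono_neutral_left ballI vanish) auto
  also have "\<dots> = 2 + run_weight (run_next a k a)"
    using assms(1) by (auto simp: run_next_def)
  also have "s * \<dots> = run_weight k"
  proof (cases "k = 0")
    case True
    then show ?thesis
      using s_less_1 by (simp add: run_next_def run_weight_def field_simps)
  next
    case False
    obtain r where r: "m - k = Suc r" "m - Suc k = r"
      using assms(2) by (cases "m - k") auto
    have "(\<Sum>i = 1..Suc r. s ^ i) = s + (\<Sum>i = 1..r. s ^ Suc i)"
      by (induction r) simp_all
    then show ?thesis
      using False r by (simp add: run_next_def run_weight_def distrib_left sum_distrib_left mult.left_commute)
  qed
  finally show ?thesis .
qed

text \<open>The words of length \<open>n\<close>, weighted by the eigenvector at the state that they lead to, have the
  total weight \<open>run_weight k / s ^ n\<close>, and the eigenvector is bounded above and away from 0.\<close>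

lemma card_words_weight:
  assumes "a \<in> {0, 1, 2}" "k < m"
  shows "2 * s * (card (words m a k n) * s ^ n) \<le> run_weight k"
    and "run_weight k \<le> 2 * s / (1 - s) * (card (words m a k n) * s ^ n)"
  using assms
proof (induction n arbitrary: a k)
  case 0
  {
    case 1
    then show ?case
      using run_weight_ge by simp
  next
    case 2
    then show ?case
      using run_weight_le by simp
  }
next
  case (Suc n)
  let ?B = "\<lambda>a k. {b \<in> {0, 1, 2}. run_next a k b < m}"
  have expand: "card (words m a k (Suc n)) * s ^ Suc n
      = s * (\<Sum>b\<in>?B a k. card (words m b (run_next a k b) n) * s ^ n)" for a k
    unfolding card_words_Suc of_nat_sum sum_distrib_right[symmetric] by simp
  {
    case 1
    have "2 * s * (card (words m a k (Suc n)) * s ^ Suc n)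
        = s * (\<Sum>b\<in>?B a k. 2 * s * (card (words m b (run_next a k b) n) * s ^ n))"
      unfolding expand by (simp only: sum_distrib_left mult.left_commute)
    also have "\<dots> \<le> s * (\<Sum>b\<in>?B a k. run_weight (run_next a k b))"
      using s_pos by (intro mult_left_mono sum_mono Suc.IH) auto
    also have "\<dots> = run_weight k"
      using 1 by (rule run_weight_step)
    finally show ?case .
  next
    case 2
    have "run_weight k = s * (\<Sum>b\<in>?B a k. run_weight (run_next a k b))"
      using run_weight_step[OF 2] by simp
    also have "\<dots> \<le> s * (\<Sum>b\<in>?B a k. 2 * s / (1 - s) * (card (words m b (run_next a k b) n) * s ^ n))"
      using s_pos by (intro mult_left_mono sum_mono Suc.IH) auto
    also have "\<dots> = 2 * s / (1 - s) * (card (words m a k (Suc n)) * s ^ Suc n)"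
      unfolding expand by (simp only: sum_distrib_left mult.left_commute)
    finally show ?case .
  }
qed

lemma card_words_bounds:
  assumes "a \<in> {0, 1, 2}" "k < m"
  shows "card (words m a k n) * s ^ n \<le> 1 / (1 - s)"
    and "1 - s \<le> card (words m a k n) * s ^ n"
proof -
  let ?c = "card (words m a k n) * s ^ n"
  have "2 * s * ?c \<le> 2 * s * (1 / (1 - s))"
    using card_words_weight(1)[OF assms, of n] run_weight_le[of k] by simp
  then show "?c \<le> 1 / (1 - s)"
    by (rule mult_left_le_imp_le) (use s_pos in simp)
  have "2 * s * (1 - s) \<le> (2 * s / (1 - s) * ?c) * (1 - s)"
    using card_words_weight(2)[OF assms, of n] run_weight_ge[OF assms(2)] s_less_1
    by (intro mult_right_mono) auto
  also have "\<dots> = 2 * s * ?c"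
    using s_less_1 by simp
  finally show "1 - s \<le> ?c"
    by (rule mult_left_le_imp_le) (use s_pos in simp)
qed

end

section \<open>Estimating Hausdorff measures\<close>

lemma hausdorff_measure_zeroI:
  fixes A :: "'a::metric_space set" and F :: "nat \<Rightarrow> 'a set set"
  assumes "0 < s" and fin: "\<And>n. finite (F n)" and cover: "\<And>n. A \<subseteq> \<Union>(F n)"
    and small: "\<And>n C. C \<in> F n \<Longrightarrow> bounded C \<and> diameter C \<le> r n"
    and lim_r: "r \<longlonglongrightarrow> 0" and lim_sum: "(\<lambda>n. card (F n) * r n powr s) \<longlonglongrightarrow> 0"
  shows "hausdorff_measure s A = 0"
proof -
  have "hausdorff_premeasure s d A = 0" if "0 < d" for d
  proof -
    have le: "hausdorff_premeasure s d A \<le> ennreal (card (F n) * r n powr s)" if "r n < d" for n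
    proof -
      let ?N = "card (F n)"
      obtain f where f: "bij_betw f {..<?N} (F n)"
        using ex_bij_betw_nat_finite[OF fin[of n]] by (auto simp: atLeast0LessThan)
      define C where "C i = (if i < ?N then f i else {})" for i
      have C_in: "C i \<in> F n" if "i < ?N" for i
        using f that by (auto simp: C_def bij_betw_def)
      have C_empty: "C i = {}" if "\<not> i < ?N" for i
        using that by (simp add: C_def)
      have "\<Union>(F n) \<subseteq> (\<Union>i. C i)"
      proof
        fix x
        assume "x \<in> \<Union>(F n)"
        then obtain i where "i < ?N" "x \<in> f i"
          using f by (auto simp: bij_betw_def)
        then show "x \<in> (\<Union>i. C i)"
          by (intro UN_I[of i]) (simp_all add: C_def)
      qed
      moreover have "bounded (C i) \<and> diameter (C i) \<le> d" for i
        using small[OF C_in[of i]] \<open>r n < d\<close> \<open>0 < d\<close> C_empty[of i]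
        by (cases "i < ?N") auto
      ultimately have "hausdorff_premeasure s d A \<le> (\<Sum>i. diam_weight s (C i))"
        unfolding hausdorff_premeasure_def using cover[of n] by (intro INF_lower) auto
      also have "\<dots> = (\<Sum>i<?N. diam_weight s (C i))"
        by (intro suminf_finite) (simp_all add: diam_weight_def C_empty)
      also have "\<dots> \<le> (\<Sum>i<?N. ennreal (r n powr s))"
      proof (intro sum_mono)
        fix i
        assume "i \<in> {..<?N}"
        then have "bounded (C i)" "diameter (C i) \<le> r n"
          using small[OF C_in[of i]] by auto
        then show "diam_weight s (C i) \<le> ennreal (r n powr s)"
          using \<open>0 < s\<close> diameter_ge_0[of "C i"]
          by (auto simp: diam_weight_def intro!: ennreal_leI powr_mono2)
      qed
      also have "\<dots> = ennreal (card (F n) * r n powr s)"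
        by (simp add: ennreal_mult'' ennreal_of_nat_eq_real_of_nat)
      finally show ?thesis .
    qed
    have "\<forall>\<^sub>F n in sequentially. r n < d"
      using lim_r \<open>0 < d\<close> by (rule order_tendstoD)
    then have "\<forall>\<^sub>F n in sequentially. hausdorff_premeasure s d A \<le> ennreal (card (F n) * r n powr s)"
      by eventually_elim (rule le)
    then have "hausdorff_premeasure s d A \<le> ennreal 0"
      by (rule tendsto_lowerbound[OF tendsto_ennrealI[OF lim_sum] _ sequentially_bot])
    then show ?thesis
      by simp
  qed
  then show ?thesis
    by (simp add: hausdorff_measure_def)
qed

lemma hausdorff_measure_zero_cover:
  fixes A :: "'a::metric_space set"
  assumes "hausdorff_measure s A = 0" "0 < e"
  shows "\<exists>C. A \<subseteq> (\<Union>i::nat. C i) \<and> (\<forall>i. bounded (C i)) \<and> (\<Sum>i. diam_weight s (C i)) < ennreal e"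
proof (rule ccontr)
  assume no_cover: "\<not> ?thesis"
  have "ennreal e \<le> hausdorff_premeasure s 1 A"
    unfolding hausdorff_premeasure_def
  proof (rule INF_greatest)
    fix C :: "nat \<Rightarrow> 'a set"
    assume "C \<in> {C. A \<subseteq> (\<Union>i. C i) \<and> (\<forall>i. bounded (C i) \<and> diameter (C i) \<le> 1)}"
    then have "A \<subseteq> (\<Union>i. C i)" "\<forall>i. bounded (C i)"
      by simp_all
    then show "ennreal e \<le> (\<Sum>i. diam_weight s (C i))"
      using no_cover not_le by blast
  qed
  also have "\<dots> \<le> hausdorff_measure s A"
    unfolding hausdorff_measure_def by (rule SUP_upper) simp
  finally show False
    using assms by simp
qed

lemma hausdorff_measure_0_pos:
  assumes "A \<noteq> {}"
  shows "hausdorff_measure 0 A \<noteq> 0"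
proof
  assume "hausdorff_measure 0 A = 0"
  then obtain C where C: "A \<subseteq> (\<Union>i. C i)" "(\<Sum>i. diam_weight 0 (C i)) < ennreal 1"
    using hausdorff_measure_zero_cover[of 0 A 1] zero_less_one by blast
  obtain i where "C i \<noteq> {}"
    using C(1) assms by blast
  then have "1 \<le> diam_weight 0 (C i)"
    by (simp add: diam_weight_def)
  also have "\<dots> \<le> (\<Sum>i. diam_weight 0 (C i))"
    using sum_le_suminf[of "\<lambda>i. diam_weight 0 (C i)" "{i}"] by simp
  finally show False
    using C(2) by simp
qed

text \<open>Countably many cylinders of total measure below 1 in the space of sequences over \<open>W\<close>, with
  the uniform product measure, leave a sequence uncovered. The measure is replaced by bookkeeping:
  the relative measure of the cylinders is averaged over the next digit, so that some digit does
  not increase it, and it stays below 1 along the whole sequence that is built in this way.\<close>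

lemma sequence_avoiding_cylinders:
  fixes v :: "nat \<Rightarrow> nat \<Rightarrow> 'b" and q :: "nat \<Rightarrow> nat"
  assumes W: "finite W" "W \<noteq> {}"
    and sum: "summable (\<lambda>i. (1 / card W) ^ q i)" "(\<Sum>i. (1 / card W) ^ q i) < 1"
  shows "\<exists>u. (\<forall>n. u n \<in> W) \<and> (\<forall>i. \<exists>n<q i. u n \<noteq> v i n)"
proof -
  let ?M = "real (card W)"
  have M: "1 \<le> ?M"
    using W by (simp add: Suc_le_eq card_gt_0_iff)
  \<comment> \<open>the relative measure of the \<open>i\<close>-th cylinder inside the cylinder of the first \<open>n\<close> entries of \<open>u\<close>;
    the truncated subtraction gives 1 when the latter is contained in the former\<close>
  define g where "g n u i = (if \<forall>r<min n (q i). u r = v i r then (1 / ?M) ^ (q i - n) else 0)"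
    for n i and u :: "nat \<Rightarrow> 'b"
  have g_nonneg: "0 \<le> g n u i" for n u i
    by (simp add: g_def)
  have g_step: "(\<Sum>b\<in>W. g (Suc n) (u(n := b)) i) \<le> ?M * g n u i" for n u i
  proof (cases "\<forall>r<min n (q i). u r = v i r")
    case agree: True
    show ?thesis
    proof (cases "q i \<le> n")
      case True
      then have "g (Suc n) (u(n := b)) i = 1" "g n u i = 1" for b
        using agree by (auto simp: g_def)
      then show ?thesis
        by simp
    next
      case False
      then have "g (Suc n) (u(n := b)) i \<le> (if b = v i n then (1 / ?M) ^ (q i - Suc n) else 0)" for b
        by (auto simp: g_def)
      then have "(\<Sum>b\<in>W. g (Suc n) (u(n := b)) i)
          \<le> (\<Sum>b\<in>W. if b = v i n then (1 / ?M) ^ (q i - Suc n) else 0)"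
        by (rule sum_mono)
      also have "\<dots> \<le> (1 / ?M) ^ (q i - Suc n)"
        using W(1) by simp
      also have "\<dots> = ?M * (1 / ?M) ^ (q i - n)"
      proof -
        have "q i - n = Suc (q i - Suc n)"
          using False by simp
        then show ?thesis
          using M by simp
      qed
      finally show ?thesis
        using agree by (simp add: g_def)
    qed
  next
    case False
    then obtain r where "r < min n (q i)" "u r \<noteq> v i r"
      by blast
    then have "r < min (Suc n) (q i) \<and> (u(n := b)) r \<noteq> v i r" for b
      by simp
    then have "g (Suc n) (u(n := b)) i = 0" for b
      unfolding g_def by metis
    then show ?thesis
      using g_nonneg[of n u i] by simp
  qed
  have g_le: "g n u i \<le> ?M ^ n * (1 / ?M) ^ q i" for n u i
  proof (cases "q i \<le> n")
    case True
    then have "?M ^ n * (1 / ?M) ^ q i = ?M ^ (n - q i)"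
      using M by (simp add: power_diff power_one_over)
    then show ?thesis
      using M True by (simp add: g_def)
  next
    case False
    then have "?M ^ n * (1 / ?M) ^ q i = (1 / ?M) ^ (q i - n)"
      using M by (simp add: power_diff power_one_over)
    then show ?thesis
      using M by (simp add: g_def)
  qed
  have g_summable: "summable (g n u)" for n u
    using g_nonneg g_le[of n u]
    by (intro summable_comparison_test'[OF summable_mult[OF sum(1), of "?M ^ n"], of 0]) simp
  have "\<exists>f. \<forall>n. ((\<forall>r. f n r \<in> W) \<and> (\<Sum>i. g n (f n) i) < 1) \<and> (\<forall>r<n. f (Suc n) r = f n r)"
  proof (rule dependent_nat_choice)
    obtain b where "b \<in> W"
      using W(2) by blast
    have "g 0 (\<lambda>_. b) = (\<lambda>i. (1 / ?M) ^ q i)"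
      by (simp add: g_def fun_eq_iff)
    then show "\<exists>u. (\<forall>r. u r \<in> W) \<and> (\<Sum>i. g 0 u i) < 1"
      using \<open>b \<in> W\<close> sum(2) by (intro exI[of _ "\<lambda>_. b"]) simp
  next
    fix u n
    assume u: "(\<forall>r. u r \<in> W) \<and> (\<Sum>i. g n u i) < 1"
    have "\<exists>b\<in>W. (\<Sum>i. g (Suc n) (u(n := b)) i) < 1"
    proof (rule ccontr)
      assume "\<not> ?thesis"
      then have "(\<Sum>b\<in>W. 1) \<le> (\<Sum>b\<in>W. \<Sum>i. g (Suc n) (u(n := b)) i)"
        by (intro sum_mono) (simp add: not_less)
      also have "\<dots> = (\<Sum>i. \<Sum>b\<in>W. g (Suc n) (u(n := b)) i)"
        by (rule suminf_sum[symmetric]) (rule g_summable)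
      also have "\<dots> \<le> (\<Sum>i. ?M * g n u i)"
        by (intro suminf_le g_step summable_sum summable_mult g_summable)
      also have "\<dots> = ?M * (\<Sum>i. g n u i)"
        by (rule suminf_mult) (rule g_summable)
      also have "\<dots> < ?M * 1"
        using u M by (intro mult_strict_left_mono) auto
      finally show False
        by simp
    qed
    then obtain b where "b \<in> W" "(\<Sum>i. g (Suc n) (u(n := b)) i) < 1"
      by blast
    then show "\<exists>u'. ((\<forall>r. u' r \<in> W) \<and> (\<Sum>i. g (Suc n) u' i) < 1) \<and> (\<forall>r<n. u' r = u r)"
      using u by (intro exI[of _ "u(n := b)"]) simp
  qed
  then obtain f where f: "\<And>n r. f n r \<in> W" "\<And>n. (\<Sum>i. g n (f n) i) < 1"
    "\<And>n r. r < n \<Longrightarrow> f (Suc n) r = f n r"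
    by blast
  define u where "u n = f (Suc n) n" for n
  have u_eq: "f n r = u r" if "r < n" for n r
    using that
  proof (induction n)
    case (Suc n)
    then show ?case
      using f(3)[of r n] by (cases "r = n") (simp_all add: u_def)
  qed simp
  have "\<exists>n<q i. u n \<noteq> v i n" for i
  proof (rule ccontr)
    assume "\<not> ?thesis"
    then have "g (q i) (f (q i)) i = 1"
      by (simp add: g_def u_eq)
    moreover have "g (q i) (f (q i)) i \<le> (\<Sum>j. g (q i) (f (q i)) j)"
      using sum_le_suminf[OF g_summable, of "{i}" "q i" "f (q i)"] g_nonneg by simp
    ultimately show False
      using f(2)[of "q i"] by simp
  qed
  then show ?thesis
    using f(1) by (intro exI[of _ u]) (simp add: u_def)
qed

lemma power_powr:
  fixes x :: real
  assumes "0 < x"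
  shows "(x ^ n) powr t = (x powr t) ^ n"
  using assms by (simp add: powr_realpow[symmetric] powr_powr powr_powr_swap mult.commute)

text \<open>A lower estimate in the manner of the mass distribution principle. By the separation, a set of
  small diameter contains only points that are coded by a single cylinder, whose measure is at most
  a multiple of the \<open>s\<close>-th power of the diameter. If the sum of these powers is too small, the
  cylinders leave a sequence uncovered, and its point is not covered either.\<close>

lemma hausdorff_measure_nonzeroI:
  fixes p :: "(nat \<Rightarrow> 'b) \<Rightarrow> 'a::metric_space"
  assumes W: "finite W" "W \<noteq> {}" and p: "\<And>u. (\<And>n. u n \<in> W) \<Longrightarrow> p u \<in> A"
    and sep: "\<And>u v n. \<lbrakk>\<And>i. u i \<in> W; \<And>i. v i \<in> W; u n \<noteq> v n; \<And>i. i < n \<Longrightarrow> u i = v i\<rbrakk>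
      \<Longrightarrow> c * \<rho> ^ n \<le> dist (p u) (p v)"
    and c: "0 < c" and \<rho>: "0 < \<rho>" "\<rho> < 1" and s: "0 < s" "1 \<le> card W * \<rho> powr s"
  shows "hausdorff_measure s A \<noteq> 0"
proof
  assume "hausdorff_measure s A = 0"
  then obtain C where C: "A \<subseteq> (\<Union>i. C i)" "\<And>i. bounded (C i)"
    and C_sum: "(\<Sum>i. diam_weight s (C i)) < ennreal (c powr s / 2)"
    using hausdorff_measure_zero_cover[of s A "c powr s / 2"] c by (auto simp del: UN_subset_iff)
  let ?d = "\<lambda>i. diameter (C i)"
  have weight: "diam_weight s (C i) = ennreal (?d i powr s)" for i
    using s(1) by (simp add: diam_weight_def diameter_def)
  have d_nonneg: "0 \<le> ?d i" for i
    by (rule diameter_ge_0) (rule C(2))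
  have d_summable: "summable (\<lambda>i. ?d i powr s)"
    using C_sum unfolding weight by (intro summable_suminf_not_top) auto
  have d_sum: "(\<Sum>i. ?d i powr s) < c powr s / 2"
    using C_sum unfolding weight
    by (subst (asm) suminf_ennreal2) (simp_all add: d_summable ennreal_less_iff suminf_nonneg)
  let ?S = "{u. \<forall>n. u n \<in> W}"
  have "\<exists>k. (\<forall>u\<in>?S. \<forall>v\<in>?S. p u \<in> C i \<longrightarrow> p v \<in> C i \<longrightarrow> (\<forall>n<k. u n = v n)) \<and>
      (\<rho> powr s) ^ k \<le> ?d i powr s / c powr s + (1 / 2) ^ (i + 2)" for i
  proof -
    have agree: "u n = v n"
      if "\<And>n. n < k \<Longrightarrow> ?d i < c * \<rho> ^ n" "u \<in> ?S" "v \<in> ?S" "p u \<in> C i" "p v \<in> C i" "n < k" for k u v n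
      using \<open>n < k\<close>
    proof (induction n rule: less_induct)
      case (less n)
      show ?case
      proof (rule ccontr)
        assume "u n \<noteq> v n"
        then have "c * \<rho> ^ n \<le> dist (p u) (p v)"
          using less that(2,3) by (intro sep) auto
        also have "\<dots> \<le> ?d i"
          using C(2) that(4,5) by (intro diameter_bounded_bound)
        finally show False
          using that(1)[of n] less.prems by simp
      qed
    qed
    have "\<exists>k. (\<forall>n<k. ?d i < c * \<rho> ^ n) \<and> (\<rho> powr s) ^ k \<le> ?d i powr s / c powr s + (1 / 2) ^ (i + 2)"
    proof (cases "?d i = 0")
      \<comment> \<open>a set of diameter 0 adds nothing to the sum, so its cylinder must be chosen arbitrarily small\<close>
      case True
      have "(\<lambda>k. (\<rho> powr s) ^ k) \<longlonglongrightarrow> 0"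
        using powr_less_mono2[of s \<rho> 1] \<rho> s(1) by (intro LIMSEQ_power_zero) simp
      then have "\<forall>\<^sub>F k in sequentially. (\<rho> powr s) ^ k < (1 / 2) ^ (i + 2)"
        by (rule order_tendstoD) simp
      then obtain k where "(\<rho> powr s) ^ k < (1 / 2) ^ (i + 2)"
        by (auto simp: eventually_sequentially)
      then show ?thesis
        using True c \<rho> by (intro exI[of _ k]) (auto simp: less_imp_le)
    next
      case False
      then have d_pos: "0 < ?d i"
        using d_nonneg[of i] by simp
      have "(\<lambda>k. c * \<rho> ^ k) \<longlonglongrightarrow> c * 0"
        using \<rho> by (intro tendsto_mult_left LIMSEQ_power_zero) simp
      then have "\<forall>\<^sub>F k in sequentially. c * \<rho> ^ k < ?d i"
        using d_pos by (intro order_tendstoD(2)[of _ 0]) auto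
      then have ex: "\<exists>k. c * \<rho> ^ k \<le> ?d i"
        by (auto simp: eventually_sequentially intro: less_imp_le)
      define k where "k = (LEAST k. c * \<rho> ^ k \<le> ?d i)"
      have k: "c * \<rho> ^ k \<le> ?d i"
        unfolding k_def using ex by (rule LeastI_ex)
      have "\<forall>n<k. ?d i < c * \<rho> ^ n"
        using not_less_Least[of _ "\<lambda>k. c * \<rho> ^ k \<le> ?d i"] unfolding k_def by (auto simp: not_le)
      moreover have "(\<rho> powr s) ^ k \<le> ?d i powr s / c powr s"
      proof -
        have "\<rho> ^ k \<le> ?d i / c"
          using k c by (simp add: le_divide_eq mult.commute)
        then have "(\<rho> ^ k) powr s \<le> (?d i / c) powr s"
          using \<rho> s(1) by (intro powr_mono2) auto
        then show ?thesis
          unfolding power_powr[OF \<rho>(1), symmetric] using c d_nonneg[of i] by (simp add: powr_divide)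
      qed
      ultimately show ?thesis
        by (intro exI[of _ k]) (auto intro: add_increasing2)
    qed
    then obtain k where k: "\<And>n. n < k \<Longrightarrow> ?d i < c * \<rho> ^ n"
      "(\<rho> powr s) ^ k \<le> ?d i powr s / c powr s + (1 / 2) ^ (i + 2)"
      by blast
    have "\<forall>u\<in>?S. \<forall>v\<in>?S. p u \<in> C i \<longrightarrow> p v \<in> C i \<longrightarrow> (\<forall>n<k. u n = v n)"
      by (intro ballI impI allI) (rule agree[OF k(1)])
    then show ?thesis
      using k(2) by (intro exI[of _ k] conjI)
  qed
  then have "\<forall>i. \<exists>k. (\<forall>u\<in>?S. \<forall>v\<in>?S. p u \<in> C i \<longrightarrow> p v \<in> C i \<longrightarrow> (\<forall>n<k. u n = v n)) \<and>
      (\<rho> powr s) ^ k \<le> ?d i powr s / c powr s + (1 / 2) ^ (i + 2)"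
    by (rule allI)
  from choice[OF this] obtain q where q: "\<And>i u v n. \<lbrakk>u \<in> ?S; v \<in> ?S; p u \<in> C i; p v \<in> C i; n < q i\<rbrakk> \<Longrightarrow> u n = v n"
    and q_le: "\<And>i. (\<rho> powr s) ^ q i \<le> ?d i powr s / c powr s + (1 / 2) ^ (i + 2)"
    by blast
  have inverse_le: "1 / card W \<le> \<rho> powr s"
    using s(2) W by (simp add: divide_le_eq mult.commute card_gt_0_iff)
  have le: "(1 / card W) ^ q i \<le> ?d i powr s / c powr s + (1 / 2) ^ (i + 2)" for i
    using power_mono[OF inverse_le, of "q i"] q_le[of i] by simp
  have half_sums: "(\<lambda>i. (1 / 2) ^ (i + 2)) sums (1 / 2 :: real)"
    using sums_mult2[OF power_half_series, of "1 / 2"] by simp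
  have bound_summable: "summable (\<lambda>i. ?d i powr s / c powr s + (1 / 2) ^ (i + 2))"
    by (intro summable_add summable_divide d_summable sums_summable[OF half_sums])
  have q_summable: "summable (\<lambda>i. (1 / card W) ^ q i)"
    by (rule summable_comparison_test'[OF bound_summable, of 0]) (use le in simp)
  have q_sum: "(\<Sum>i. (1 / card W) ^ q i) < 1"
  proof -
    have "(\<Sum>i. (1 / card W) ^ q i) \<le> (\<Sum>i. ?d i powr s / c powr s + (1 / 2) ^ (i + 2))"
      by (intro suminf_le le q_summable bound_summable)
    also have "\<dots> = (\<Sum>i. ?d i powr s) / c powr s + 1 / 2"
      using suminf_add[OF summable_divide[OF d_summable] sums_summable[OF half_sums], of "c powr s"]
        suminf_divide[OF d_summable, of "c powr s"] sums_unique[OF half_sums] by simp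
    also have "(\<Sum>i. ?d i powr s) / c powr s < 1 / 2"
      using d_sum c by (simp add: divide_less_eq)
    finally show ?thesis
      by simp
  qed
  define v where "v i = (SOME u. u \<in> ?S \<and> p u \<in> C i)" for i
  obtain u where u_W: "\<forall>n. u n \<in> W" and u_avoids: "\<forall>i. \<exists>n<q i. u n \<noteq> v i n"
    using sequence_avoiding_cylinders[OF W q_summable q_sum, of v] by (elim exE conjE)
  have u: "u \<in> ?S"
    using u_W by simp
  then obtain i where i: "p u \<in> C i"
    using p[of u] C(1) u_W by blast
  then have "v i \<in> ?S \<and> p (v i) \<in> C i"
    unfolding v_def using u i by (intro someI_ex[of "\<lambda>u. u \<in> ?S \<and> p u \<in> C i"]) blast
  then have "u n = v i n" if "n < q i" for n
    using q[OF u _ i _ that, of "v i"] by blast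
  then show False
    using u_avoids by blast
qed

section \<open>The dimension of the set of uniqueness\<close>

locale uniqueness_dimension = multinacci_ratio l m + run_growth s m for l m s
begin

text \<open>Cylinders of length \<open>n + 1\<close> have diameter of order \<open>l ^ n\<close>, and of order \<open>(1 / s) ^ n\<close> of them
  meet the set of unique addresses.\<close>

lemma hausdorff_measure_uniqueness_set_zero:
  assumes "0 < t" "l powr t < s"
  shows "hausdorff_measure t (uniqueness_set l) = 0"
proof -
  define W where "W n = (\<Union>b\<in>{0, 1, 2}. (#) b ` words m b 0 n)" for n
  define F where "F n = (\<lambda>w. point l ` {\<epsilon> \<in> codes. map \<epsilon> [0..<Suc n] = w}) ` W n" for n
  show ?thesis
  proof (rule hausdorff_measure_zeroI[where F = F and r = "\<lambda>n. 2 * l ^ Suc n"])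
    show "0 < t"
      by fact
    show fin: "finite (F n)" for n
      by (simp add: F_def W_def)
    show "uniqueness_set l \<subseteq> \<Union>(F n)" for n
    proof
      fix x
      assume "x \<in> uniqueness_set l"
      then obtain \<epsilon> where \<epsilon>: "\<epsilon> \<in> unique_codes l" "x = point l \<epsilon>"
        by (auto simp: uniqueness_set_eq)
      then have codes: "\<epsilon> \<in> codes"
        by (intro unique_codesD)
      have "follows m (\<epsilon> 0) 0 (tail 1 \<epsilon>)"
        using \<epsilon>(1) unique_codes_iff[OF codes] by simp
      then have tail_word: "map (tail 1 \<epsilon>) [0..<n] \<in> words m (\<epsilon> 0) 0 n"
        using \<epsilon>(1) codes m_ge_2
        by (intro prefix_in_words tail_codes admissible_tail unique_codes_admissible) auto
      have "map \<epsilon> [0..<Suc n] = \<epsilon> 0 # map (tail 1 \<epsilon>) [0..<n]"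
        by (simp only: map_upt_Suc) (simp add: tail_def)
      also have "\<dots> \<in> W n"
        unfolding W_def using codesD[OF codes, of 0] tail_word by (intro UN_I[of "\<epsilon> 0"]) simp_all
      finally have "map \<epsilon> [0..<Suc n] \<in> W n" .
      then show "x \<in> \<Union>(F n)"
        unfolding F_def using codes \<epsilon>(2) by blast
    qed
    show "bounded C \<and> diameter C \<le> 2 * l ^ Suc n" if C_in: "C \<in> F n" for n C
    proof
      obtain w where C: "C = point l ` {\<epsilon> \<in> codes. map \<epsilon> [0..<Suc n] = w}"
        using C_in unfolding F_def by blast
      show "bounded C"
        unfolding C bounded_iff using norm_point_le by blast
      show "diameter C \<le> 2 * l ^ Suc n"
      proof (rule diameter_le)
        show "C \<noteq> {} \<or> 0 \<le> 2 * l ^ Suc n"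
          using l_pos by simp
        fix x y
        assume "x \<in> C" "y \<in> C"
        from \<open>x \<in> C\<close> obtain \<epsilon> where \<epsilon>: "x = point l \<epsilon>" "map \<epsilon> [0..<Suc n] = w"
          unfolding C by blast
        from \<open>y \<in> C\<close> obtain \<eta> where \<eta>: "y = point l \<eta>" "map \<eta> [0..<Suc n] = w"
          unfolding C by blast
        have "\<epsilon> i = \<eta> i" if "i < Suc n" for i
        proof -
          have "map \<epsilon> [0..<Suc n] ! i = map \<eta> [0..<Suc n] ! i"
            unfolding \<epsilon>(2) \<eta>(2) ..
          then show ?thesis
            using that by (simp del: upt_Suc)
        qed
        then show "norm (x - y) \<le> 2 * l ^ Suc n"
          unfolding dist_norm[symmetric] \<epsilon>(1) \<eta>(1) by (rule dist_point_le)
      qed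
    qed
    show "(\<lambda>n. 2 * l ^ Suc n) \<longlonglongrightarrow> 0"
      using l_pos l_less_1 by (intro tendsto_mult_right_zero LIMSEQ_Suc LIMSEQ_power_zero) simp
    let ?K = "3 / (1 - s) * (2 * l) powr t"
    have card_le: "card (F n) * (2 * l ^ Suc n) powr t \<le> ?K * (l powr t / s) ^ n" for n
    proof -
      have "card (F n) \<le> card (W n)"
        unfolding F_def W_def by (intro card_image_le) simp
      also have "\<dots> \<le> (\<Sum>b\<in>{0, 1, 2}. card ((#) b ` words m b 0 n))"
        unfolding W_def by (rule card_UN_le) simp
      also have "\<dots> = (\<Sum>b\<in>{0, 1, 2}. card (words m b 0 n))"
        by (simp add: card_image)
      finally have "real (card (F n)) \<le> (\<Sum>b\<in>{0, 1, 2}. real (card (words m b 0 n)))"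
        by (simp only: of_nat_sum[symmetric] of_nat_le_iff)
      also have "\<dots> \<le> (\<Sum>b\<in>{0, 1, 2::nat}. 1 / (1 - s) / s ^ n)"
      proof (rule sum_mono)
        fix b :: nat
        assume "b \<in> {0, 1, 2}"
        then show "real (card (words m b 0 n)) \<le> 1 / (1 - s) / s ^ n"
          using card_words_bounds(1)[of b 0 n] m_ge_2 s_pos
          by (simp only: pos_le_divide_eq zero_less_power)
      qed
      finally have "real (card (F n)) \<le> 3 / (1 - s) / s ^ n"
        by simp
      then have "card (F n) * ((2 * l) powr t * (l powr t) ^ n)
          \<le> 3 / (1 - s) / s ^ n * ((2 * l) powr t * (l powr t) ^ n)"
        by (rule mult_right_mono) simp
      moreover have "(2 * l ^ Suc n) powr t = (2 * l) powr t * (l powr t) ^ n"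
        using l_pos by (simp add: powr_mult power_powr)
      ultimately have "card (F n) * (2 * l ^ Suc n) powr t
          \<le> 3 / (1 - s) / s ^ n * ((2 * l) powr t * (l powr t) ^ n)"
        by simp
      then show ?thesis
        by (simp add: power_divide mult.assoc)
    qed
    have "l powr t / s < 1"
      using assms(2) s_pos by simp
    then have "(\<lambda>n. (l powr t / s) ^ n) \<longlonglongrightarrow> 0"
      using s_pos by (intro LIMSEQ_power_zero) simp
    then have "(\<lambda>n. ?K * (l powr t / s) ^ n) \<longlonglongrightarrow> 0"
      by (rule tendsto_mult_right_zero)
    then show "(\<lambda>n. card (F n) * (2 * l ^ Suc n) powr t) \<longlonglongrightarrow> 0"
      by (rule Lim_null_comparison[rotated]) (use card_le in simp)
  qed
qed

end

lemma words_Cons: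
  assumes "2 \<le> m" "b \<in> {0, 1, 2}" "b \<noteq> a" "w \<in> words m b 1 n"
  shows "b # w \<in> words m a k (Suc n)"
  unfolding words.simps using assms by (intro UN_I[of b] imageI) (simp_all add: run_next_def)

definition no_long_run :: "nat \<Rightarrow> nat list \<Rightarrow> bool" where
  "no_long_run m w \<longleftrightarrow>
     (\<forall>p j. p + m < length w \<longrightarrow> w ! p \<noteq> j \<longrightarrow> (\<exists>i<m. w ! (Suc p + i) \<noteq> j))"

lemma words_not_begins:
  assumes "w \<in> words m a k n" "k \<noteq> 0" "k < m" "m - k \<le> n"
  shows "\<exists>i<m - k. w ! i \<noteq> a"
  using assms
proof (induction n arbitrary: k w)
  case (Suc n)
  then obtain b w' where w: "w = b # w'" "run_next a k b < m" "w' \<in> words m b (run_next a k b) n"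
    by auto
  show ?case
  proof (cases "b = a")
    case True
    then have "Suc k < m" "w' \<in> words m a (Suc k) n"
      using w Suc.prems(2) by (auto simp: run_next_def)
    moreover have "m - Suc k \<le> n"
      using Suc.prems(4) by linarith
    ultimately obtain i where "i < m - Suc k" "w' ! i \<noteq> a"
      using Suc.IH[of w' "Suc k"] by auto
    then show ?thesis
      using w(1) by (intro exI[of _ "Suc i"]) simp
  next
    case False
    then show ?thesis
      using w(1) Suc.prems(3) by (intro exI[of _ 0]) simp
  qed
qed simp

lemma no_long_run_words:
  assumes "2 \<le> m" "w \<in> words m a k n"
  shows "no_long_run m (a # w)"
  using assms(2)
proof (induction n arbitrary: a k w)
  case 0
  then show ?case
    using assms(1) by (simp add: no_long_run_def)
next
  case (Suc n)
  then obtain b w' where w: "w = b # w'" "w' \<in> words m b (run_next a k b) n"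
    by auto
  have IH: "no_long_run m (b # w')"
    using w(2) by (rule Suc.IH)
  show ?case
    unfolding no_long_run_def
  proof (intro allI impI)
    fix p j
    assume p: "p + m < length (a # w)" "(a # w) ! p \<noteq> j"
    show "\<exists>i<m. (a # w) ! (Suc p + i) \<noteq> j"
    proof (cases p)
      case 0
      show ?thesis
      proof (cases "b = j")
        case True
        then have "w' \<in> words m j 1 n" "m - 1 \<le> n"
          using w p 0 length_words[OF w(2)] by (auto simp: run_next_def)
        then obtain i where "i < m - 1" "w' ! i \<noteq> j"
          using words_not_begins[of w' m j 1 n] assms(1) by auto
        then show ?thesis
          using 0 w(1) by (intro exI[of _ "Suc i"]) simp
      next
        case False
        then show ?thesis
          using 0 w(1) assms(1) by (intro exI[of _ 0]) simp
      qed
    next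
      case (Suc p')
      then show ?thesis
        using IH p w(1) by (simp add: no_long_run_def)
    qed
  qed
qed

lemma no_long_run_snoc:
  assumes "2 \<le> m" "no_long_run m w" "w \<noteq> []" "e \<noteq> last w"
  shows "no_long_run m (w @ [e])"
  unfolding no_long_run_def
proof (intro allI impI)
  fix p j
  assume p: "p + m < length (w @ [e])" "(w @ [e]) ! p \<noteq> j"
  show "\<exists>i<m. (w @ [e]) ! (Suc p + i) \<noteq> j"
  proof (cases "p + m < length w")
    case True
    then obtain i where "i < m" "w ! (Suc p + i) \<noteq> j"
      using assms(1,2) p(2) by (auto simp: no_long_run_def nth_append)
    then show ?thesis
      using True by (intro exI[of _ i]) (simp add: nth_append)
  next
    case False
    then have len: "length w = p + m"
      using p(1) by simp
    then have "(w @ [e]) ! (Suc p + (m - 1)) = e"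
      using assms(1) by (simp add: nth_append)
    moreover have "(w @ [e]) ! (Suc p + (m - 2)) = last w"
    proof -
      have "Suc p + (m - 2) = length w - 1" "length w - 1 < length w"
        using assms(1) len by linarith+
      then show ?thesis
        using last_conv_nth[OF assms(3)] by (metis nth_append)
    qed
    moreover have "m - 1 < m" "m - 2 < m"
      using assms(1) by simp_all
    ultimately show ?thesis
      using assms(4) by metis
  qed
qed

text \<open>Blocks that can be concatenated freely. For every digit \<open>j\<close> the separator \<open>0 1 2 0\<close> contains
  two consecutive digits other than \<open>j\<close>, which makes addresses composed of blocks \<open>spread\<close>. The
  last digit of a block differs from 0, so that no run continues into the next block, and from the
  digit before it, so that it prolongs no run.\<close>

definition block :: "nat list \<Rightarrow> nat list" where
  "block w = (0 # 1 # 2 # 0 # w) @ [if last (0 # w) = 1 then 2 else 1]"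

definition concat_blocks :: "nat \<Rightarrow> (nat \<Rightarrow> nat list) \<Rightarrow> nat \<Rightarrow> nat" where
  "concat_blocks N u i = u (i div N) ! (i mod N)"

lemma inj_block: "inj block"
  by (rule injI) (simp add: block_def)

lemma block_properties:
  assumes "2 \<le> m" "w \<in> words m 0 1 n"
  shows "length (block w) = n + 5" "set (block w) \<subseteq> {0, 1, 2}" "no_long_run m (block w)"
    and "block w ! 0 = 0" "block w ! 1 = 1" "block w ! 2 = 2" "block w ! 3 = 0"
    and "block w ! (n + 4) \<noteq> 0"
proof -
  have len: "length w = n"
    using assms(2) by (rule length_words)
  show "length (block w) = n + 5" "block w ! 0 = 0" "block w ! 1 = 1" "block w ! 2 = 2" "block w ! 3 = 0"
    "block w ! (n + 4) \<noteq> 0"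
    by (simp_all add: block_def len nth_append numeral_2_eq_2 numeral_3_eq_3)
  show "set (block w) \<subseteq> {0, 1, 2}"
    using set_words[OF assms(2)] by (auto simp: block_def)
  have "1 # 2 # 0 # w \<in> words m 0 1 (Suc (Suc (Suc n)))"
    using assms by (intro words_Cons) simp_all
  then have "no_long_run m (0 # 1 # 2 # 0 # w)"
    by (rule no_long_run_words[OF assms(1)])
  then show "no_long_run m (block w)"
    unfolding block_def by (intro no_long_run_snoc assms(1)) auto
qed

context multinacci_ratio
begin

context
  fixes n N :: nat and u :: "nat \<Rightarrow> nat list"
  assumes N: "N = n + 5" and u: "\<And>k. u k \<in> block ` words m 0 1 n"
begin

lemma concat_blocks_apply: "r < N \<Longrightarrow> concat_blocks N u (k * N + r) = u k ! r"
  by (simp add: concat_blocks_def)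

lemma blocks:
  "length (u k) = N" "set (u k) \<subseteq> {0, 1, 2}" "no_long_run m (u k)"
  "u k ! 0 = 0" "u k ! 1 = 1" "u k ! 2 = 2" "u k ! 3 = 0" "u k ! (N - 1) \<noteq> 0"
proof -
  obtain w where "w \<in> words m 0 1 n" "u k = block w"
    using u[of k] by blast
  then show "length (u k) = N" "set (u k) \<subseteq> {0, 1, 2}" "no_long_run m (u k)"
    "u k ! 0 = 0" "u k ! 1 = 1" "u k ! 2 = 2" "u k ! 3 = 0" "u k ! (N - 1) \<noteq> 0"
    using block_properties[OF m_ge_2, of w n] by (simp_all add: N add.commute[of 4])
qed

lemma concat_blocks_codes: "concat_blocks N u \<in> codes"
proof -
  have "u k ! r \<in> {0, 1, 2}" if "r < N" for k r
    using blocks(1,2)[of k] that nth_mem by blast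
  then show ?thesis
    by (simp add: codes_def concat_blocks_def N)
qed

lemma concat_blocks_admissible: "admissible m (concat_blocks N u)"
  unfolding admissible_def follows_def
proof (intro allI conjI impI notI)
  let ?\<epsilon> = "concat_blocks N u"
  fix i j
  assume j: "j \<noteq> ?\<epsilon> i" and begins: "begins_with_run j m (tail (Suc i) ?\<epsilon>)"
  have run: "?\<epsilon> p = j" if "i < p" "p \<le> i + m" for p
  proof -
    have "p - Suc i < m" "Suc i + (p - Suc i) = p"
      using that by auto
    then show ?thesis
      using begins unfolding begins_with_run_def tail_apply by metis
  qed
  define k r where "k = i div N" and "r = i mod N"
  have i: "i = k * N + r" "r < N"
    using mod_less_divisor[of N i] by (simp add: k_def r_def, simp add: r_def N)
  show False
  proof (cases "r + m < N")
    case True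
    have "u k ! r \<noteq> j"
      using j concat_blocks_apply[OF i(2)] i(1) by metis
    then obtain a where a: "a < m" "u k ! (Suc r + a) \<noteq> j"
      using blocks(1,3)[of k] True unfolding no_long_run_def by metis
    have "?\<epsilon> (k * N + (Suc r + a)) = u k ! (Suc r + a)"
      using a(1) True by (intro concat_blocks_apply) simp
    moreover have "?\<epsilon> (k * N + (Suc r + a)) = j"
      using a(1) i(1) by (intro run) auto
    ultimately show False
      using a(2) by simp
  next
    case False
    \<comment> \<open>the run would extend to the beginning \<open>0 1\<close> of the next block\<close>
    define P where "P = Suc k * N"
    have P: "i < P" "P \<le> i + m"
      using i False by (simp_all add: P_def)
    have "?\<epsilon> P = 0" "?\<epsilon> (P + 1) = 1"
      using concat_blocks_apply[of 0 "Suc k"] concat_blocks_apply[of 1 "Suc k"] blocks(4,5)[of "Suc k"]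
      unfolding P_def by (simp_all add: N)
    then have "j = 0"
      using run[OF P] by simp
    have "?\<epsilon> (P - 1) \<noteq> 0"
    proof -
      have "P - 1 = k * N + (N - 1)" "N - 1 < N"
        by (simp_all add: P_def N)
      then show ?thesis
        using concat_blocks_apply[of "N - 1" k] blocks(8)[of k] by simp
    qed
    then have "\<not> (i < P - 1 \<and> P - 1 \<le> i + m)"
      using run[of "P - 1"] \<open>j = 0\<close> by auto
    then have "P = Suc i"
      using P by linarith
    then have "?\<epsilon> (P + 1) = j"
      using m_ge_2 by (intro run) auto
    then show False
      using \<open>?\<epsilon> (P + 1) = 1\<close> \<open>j = 0\<close> by simp
  qed
qed simp

lemma concat_blocks_spread: "spread (2 * N) (concat_blocks N u)"
  unfolding spread_def
proof (intro ballI allI)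
  let ?\<epsilon> = "concat_blocks N u"
  fix j i :: nat
  assume j: "j \<in> {0, 1, 2}"
  define k where "k = Suc (i div N)"
  have "i mod N < N"
    by (simp add: N)
  moreover have "k * N = i div N * N + N"
    by (simp add: k_def)
  ultimately have "i < k * N"
    using div_mult_mod_eq[of i N] by linarith
  have "k * N \<le> i + N"
    using div_times_less_eq_dividend[of i N] by (simp add: k_def)
  have "?\<epsilon> (k * N + 0) = 0" "?\<epsilon> (k * N + 1) = 1" "?\<epsilon> (k * N + 2) = 2" "?\<epsilon> (k * N + 3) = 0"
    using blocks(4-7)[of k] by (subst concat_blocks_apply; simp add: N)+
  then have "\<exists>q\<le>2. ?\<epsilon> (k * N + q) \<noteq> j \<and> ?\<epsilon> (k * N + Suc q) \<noteq> j"
    using j by (auto simp: numeral_3_eq_3 numeral_2_eq_2 intro: exI[of _ 0] exI[of _ 1] exI[of _ 2])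
  then obtain q where q: "q \<le> 2" "?\<epsilon> (k * N + q) \<noteq> j \<and> ?\<epsilon> (Suc (k * N + q)) \<noteq> j"
    by auto
  then show "\<exists>p\<in>{i..i + 2 * N}. ?\<epsilon> p \<noteq> j \<and> ?\<epsilon> (Suc p) \<noteq> j"
    using \<open>i < k * N\<close> \<open>k * N \<le> i + N\<close> by (intro bexI[of _ "k * N + q"]) (auto simp: N)
qed

end

end

context uniqueness_dimension
begin

text \<open>The growth rate \<open>1 / s\<close> is approached by the blocks of length \<open>n + 5\<close>, since the five additional
  digits cost only a constant factor in the number of words.\<close>

lemma hausdorff_measure_uniqueness_set_nonzero:
  assumes "0 < t" "s < l powr t"
  shows "hausdorff_measure t (uniqueness_set l) \<noteq> 0"
proof -
  let ?L = "l powr t"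
  have "1 < ?L / s"
    using assms(2) s_pos by simp
  then obtain n where n: "1 / ((1 - s) * ?L ^ 5) < (?L / s) ^ n"
    using real_arch_pow by blast
  define N where N: "N = n + 5"
  define W where "W = block ` words m 0 1 n"
  have card_W: "card W = card (words m 0 1 n)"
    unfolding W_def by (rule card_image) (rule inj_on_subset[OF inj_block], simp)
  have many: "1 \<le> card W * (l ^ N) powr t"
  proof -
    have "1 \<le> (?L / s) ^ n * ((1 - s) * ?L ^ 5)"
      using n s_less_1 l_pos by (simp add: divide_less_eq)
    also have "\<dots> = (1 - s) / s ^ n * ?L ^ N"
      by (simp add: N power_add power_divide)
    also have "\<dots> \<le> card W * ?L ^ N"
      using card_words_bounds(2)[of 0 1 n] m_ge_2 s_pos
      by (intro mult_right_mono) (simp_all add: card_W divide_le_eq)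
    also have "?L ^ N = (l ^ N) powr t"
      using l_pos by (simp add: power_powr)
    finally show ?thesis .
  qed
  \<comment> \<open>blocks that differ first at \<open>k\<close> give addresses that differ first before \<open>(k + 1) * N\<close>, and
    \<open>spread_separation\<close> loses another \<open>2 * N\<close> digits\<close>
  show ?thesis
  proof (rule hausdorff_measure_nonzeroI[where W = W and p = "\<lambda>u. point l (concat_blocks N u)"
        and c = "(1 - l)\<^sup>2 * l ^ (3 * N)" and \<rho> = "l ^ N"])
    show "finite W"
      by (simp add: W_def)
    show "W \<noteq> {}"
      using many by auto
    show "point l (concat_blocks N u) \<in> uniqueness_set l" if "\<And>k. u k \<in> W" for u
      unfolding uniqueness_set_eq using that
      by (intro imageI spread_unique[of _ "2 * N"] concat_blocks_codes[OF N] concat_blocks_admissible[OF N]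
          concat_blocks_spread[OF N]) (simp_all add: W_def)
    show "0 < (1 - l)\<^sup>2 * l ^ (3 * N)" "0 < l ^ N" "l ^ N < 1" "0 < t"
      using l_pos l_less_1 assms(1) by (simp_all add: N power_less_one_iff)
    show "1 \<le> card W * (l ^ N) powr t"
      by (fact many)
    show "(1 - l)\<^sup>2 * l ^ (3 * N) * (l ^ N) ^ k \<le> dist (point l (concat_blocks N u)) (point l (concat_blocks N v))"
      if uv: "\<And>i. u i \<in> W" "\<And>i. v i \<in> W" and diff: "u k \<noteq> v k" for u v k
    proof -
      let ?\<epsilon> = "concat_blocks N u" and ?\<eta> = "concat_blocks N v"
      have uv': "\<And>i. u i \<in> block ` words m 0 1 n" "\<And>i. v i \<in> block ` words m 0 1 n"
        using uv by (simp_all add: W_def)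
      have "length (u k) = N" "length (v k) = N"
        using blocks(1)[OF N] uv' by blast+
      then obtain r where r: "r < N" "u k ! r \<noteq> v k ! r"
        using diff nth_equalityI by metis
      then have ex: "?\<epsilon> (k * N + r) \<noteq> ?\<eta> (k * N + r)"
        by (simp add: concat_blocks_def)
      define i where "i = (LEAST i. ?\<epsilon> i \<noteq> ?\<eta> i)"
      have i: "?\<epsilon> i \<noteq> ?\<eta> i" "i \<le> k * N + r"
        unfolding i_def using ex by (rule LeastI, rule Least_le)
      have before: "?\<epsilon> h = ?\<eta> h" if "h < i" for h
        using not_less_Least[of h "\<lambda>i. ?\<epsilon> i \<noteq> ?\<eta> i"] that unfolding i_def by blast
      have "(1 - l)\<^sup>2 * l ^ (3 * N) * (l ^ N) ^ k = l ^ (3 * N + N * k) * (1 - l)\<^sup>2"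
        by (simp add: power_add power_mult)
      also have "\<dots> \<le> l ^ (i + 2 * N) * (1 - l)\<^sup>2"
        using i(2) r(1) l_pos l_less_1
        by (intro mult_right_mono power_decreasing) (auto simp: mult.commute)
      also have "\<dots> \<le> dist (point l ?\<epsilon>) (point l ?\<eta>)"
        using uv' i(1) before
        by (intro spread_separation concat_blocks_codes[OF N] concat_blocks_admissible[OF N]
            concat_blocks_spread[OF N])
      finally show ?thesis .
    qed
  qed
qed

lemma hausdorff_dim_uniqueness_set: "hausdorff_dim (uniqueness_set l) = ereal (ln s / ln l)"
proof -
  let ?d = "ln s / ln l"
  have ln_neg: "ln l < 0" "ln s < 0"
    using l_pos l_less_1 s_pos s_less_1 by simp_all
  then have d_pos: "0 < ?d"
    by (simp add: divide_neg_neg)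
  have above: "hausdorff_measure t (uniqueness_set l) = 0" if "?d < t" for t
  proof (rule hausdorff_measure_uniqueness_set_zero)
    show "0 < t"
      using d_pos that by simp
    have "t * ln l < ln s"
      using that ln_neg by (simp add: neg_divide_less_eq)
    then have "exp (t * ln l) < exp (ln s)"
      by simp
    then show "l powr t < s"
      using l_pos s_pos by (simp add: powr_def)
  qed
  have below: "?d \<le> t" if "0 \<le> t" "hausdorff_measure t (uniqueness_set l) = 0" for t
  proof (rule ccontr)
    assume t: "\<not> ?d \<le> t"
    have "uniqueness_set l \<noteq> {}"
      unfolding uniqueness_set_eq using cyclic_code(1) by blast
    then have "0 < t"
      using that hausdorff_measure_0_pos by (cases "t = 0") auto
    have "ln s < t * ln l"
      using t ln_neg by (simp add: not_le less_divide_eq)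
    then have "exp (ln s) < exp (t * ln l)"
      by simp
    then have "s < l powr t"
      using l_pos s_pos by (simp add: powr_def)
    then show False
      using hausdorff_measure_uniqueness_set_nonzero[OF \<open>0 < t\<close>] that(2) by simp
  qed
  show ?thesis
    unfolding hausdorff_dim_def
  proof (rule antisym)
    show "Inf {ereal t |t. 0 \<le> t \<and> hausdorff_measure t (uniqueness_set l) = 0} \<le> ereal ?d"
    proof (rule ereal_le_epsilon2)
      fix e :: real
      assume "0 < e"
      then have "hausdorff_measure (?d + e) (uniqueness_set l) = 0"
        by (intro above) simp
      then show "Inf {ereal t |t. 0 \<le> t \<and> hausdorff_measure t (uniqueness_set l) = 0} \<le> ereal ?d + ereal e"
        using d_pos \<open>0 < e\<close> by (intro Inf_lower) (auto intro!: exI[of _ "?d + e"])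
    qed
    show "ereal ?d \<le> Inf {ereal t |t. 0 \<le> t \<and> hausdorff_measure t (uniqueness_set l) = 0}"
      using below by (intro Inf_greatest) auto
  qed
qed

end

theorem theoremA4:
  fixes m :: nat
  assumes "m \<ge> 2"
  shows "self_similar (uniqueness_set (multinacci m)) \<and>
         hausdorff_dim (uniqueness_set (multinacci m)) =
           ereal (ln (sigma_root m) / ln (multinacci m)) \<and>
         0 < sigma_root m \<and> sigma_root m < 1 \<and>
         sigma_root 2 = 1 / 2"
proof -
  interpret uniqueness_dimension "multinacci m" m "sigma_root m"
    by unfold_locales (use assms multinacci_root[OF assms] sigma_root_geometric_sum[OF assms] in auto)
  have "sigma_root 2 = 1 / 2"
    using sigma_root_geometric_sum(3)[of 2] by simp
  then show ?thesis
    using self_similar_uniqueness_set hausdorff_dim_uniqueness_set s_pos s_less_1 by blast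
qed

end
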